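(* Let $(M,g)$ be a connected $n$-dimensional Riemannian manifold and let its tangent bundle $TM$ be equipped with the metric $\tilde g = a g_1 + b g_2 + c g_3$, where $a,b,c$ are positive real numbers with $ac-b^2\neq 0$. Let $V$ be a vector field on $M$. (i) If the complete lift $X^C$ of $V$ is a conformal vector field on $(TM,\tilde g)$, then $X^C$ is homothetic. (ii) If the horizontal lift $X^H$ of $V$ is a conformal vector field on $(TM,\tilde g)$, then $X^H$ is a Killing vector field of $(TM,\tilde g)$; likewise, if the vertical lift $X^V$ of $V$ is a conformal vector field on $(TM,\tilde g)$, then $X^V$ is a Killing vector field of $(TM,\tilde g)$.
   Context: Manifolds, metrics, vector fields and functions are smooth. Let $(x^i)$ be local coordinates on $M$, $(x^i,y^i)$ the induced coordinates on $TM$, $g_{ij}$ the components of $g$, and $\Gamma_{j\ i}^{\ k}$ the coefficients (Christoffel symbols) of the Riemannian (Levi-Civita) connection of $g$. Summation over repeated indices is understood. Adapted frame on $TM$: $X_h = \frac{\partial}{\partial x^h} - y^a\Gamma_{a\ h}^{\ m}\frac{\partial}{\partial y^m}$ and $X_{\bar h} = \frac{\partial}{\partial y^h}$. Its dual basis is $\{dx^h,\delta y^h\}$ with $\delta y^h = dy^h + y^a\Gamma_{a\ i}^{\ h}dx^i$. Globally defined symmetric bilinear forms on $TM$: $g_1 = g_{ij}dx^i dx^j$, $g_2 = 2g_{ij}dx^i\delta y^j$, $g_3 = g_{ij}\delta y^i\delta y^j$. Thus $\tilde g = a g_1+b g_2+c g_3$ is given by $\tilde g(X_i,X_j)=a g_{ij}$,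 $\tilde g(X_i,X_{\bar j}) = b g_{ij}$, $\tilde g(X_{\bar i},X_{\bar j}) = c g_{ij}$. When $ac-b^2\ne 0$ this is a nondegenerate (Riemannian or pseudo-Riemannian) metric on $TM$. For a vector field $V=V^h\frac{\partial}{\partial x^h}$ on $M$, its complete, horizontal and vertical lifts to $TM$ are $X^C = V^hX_h + y^m(\Gamma_{m\ a}^{\ h}V^a+\partial_mV^h)X_{\bar h}$, $X^H = V^hX_h$, $X^V = V^hX_{\bar h}$, where $\partial_m = \frac{\partial}{\partial x^m}$. A vector field $X$ on $TM$ is conformal (with respect to $\tilde g$) if there is a scalar function $\Omega$ on $TM$ with $\mathcal{L}_X\tilde g = 2\Omega\tilde g$, where $\mathcal{L}_X$ is the Lie derivative; it is homothetic if $\Omega$ is constant, and a Killing vector field if $\Omega = 0$. *)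

theory Defs
  imports "HOL-Analysis.Analysis"
begin

section \<open>Smooth maps on open subsets of Euclidean spaces\<close>

primrec Ck_on :: "nat \<Rightarrow> ('e::euclidean_space \<Rightarrow> 'b::real_normed_vector) \<Rightarrow> 'e set \<Rightarrow> bool" where
  "Ck_on 0 f S \<longleftrightarrow> continuous_on S f"
| "Ck_on (Suc k) f S \<longleftrightarrow> (\<forall>x\<in>S. f differentiable (at x)) \<and>
     (\<forall>v. Ck_on k (\<lambda>x. frechet_derivative f (at x) v) S)"

definition smooth_on :: "('e::euclidean_space \<Rightarrow> 'b::real_normed_vector) \<Rightarrow> 'e set \<Rightarrow> bool" where
  "smooth_on f S \<longleftrightarrow> (\<forall>k. Ck_on k f S)"

definition partial_deriv :: "(real^'n \<Rightarrow> real) \<Rightarrow> 'n \<Rightarrow> real^'n \<Rightarrow> real" where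
  "partial_deriv f i x = frechet_derivative f (at x) (axis i 1)"


section \<open>Smooth manifolds\<close>

text \<open>A topological space with an indexed atlas of charts \<open>(cdom \<alpha>, cmap \<alpha>)\<close>,
  \<open>\<alpha> \<in> charts\<close>, modelled on \<open>'e\<close>. Any atlas can be indexed by itself; the indices make it easy
  to let the tangent bundle carry an atlas with the same index set.\<close>

record ('p, 'i, 'e) manifold =
  mtop :: "'p topology"
  charts :: "'i set"
  cdom :: "'i \<Rightarrow> 'p set"
  cmap :: "'i \<Rightarrow> 'p \<Rightarrow> 'e"

definition chart_inv :: "('p, 'i, 'e) manifold \<Rightarrow> 'i \<Rightarrow> 'e \<Rightarrow> 'p" where
  "chart_inv M \<alpha> = inv_into (cdom M \<alpha>) (cmap M \<alpha>)"

definition transition :: "('p, 'i, 'e) manifold \<Rightarrow> 'i \<Rightarrow> 'i \<Rightarrow> 'e \<Rightarrow> 'e" where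
  "transition M \<alpha> \<beta> = cmap M \<beta> \<circ> chart_inv M \<alpha>"

definition smooth_manifold :: "('p, 'i, 'e::euclidean_space) manifold \<Rightarrow> bool" where
  "smooth_manifold M \<longleftrightarrow>
     Hausdorff_space (mtop M) \<and> second_countable (mtop M) \<and>
     topspace (mtop M) = (\<Union>\<alpha>\<in>charts M. cdom M \<alpha>) \<and>
     (\<forall>\<alpha>\<in>charts M. openin (mtop M) (cdom M \<alpha>) \<and> open (cmap M \<alpha> ` cdom M \<alpha>) \<and>
        homeomorphic_map (subtopology (mtop M) (cdom M \<alpha>))
          (top_of_set (cmap M \<alpha> ` cdom M \<alpha>)) (cmap M \<alpha>)) \<and>
     (\<forall>\<alpha>\<in>charts M. \<forall>\<beta>\<in>charts M.
        smooth_on (transition M \<alpha> \<beta>) (cmap M \<alpha> ` (cdom M \<alpha> \<inter> cdom M \<beta>)))"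

definition smooth_function :: "('p, 'i, 'e::euclidean_space) manifold \<Rightarrow> ('p \<Rightarrow> real) \<Rightarrow> bool" where
  "smooth_function M f \<longleftrightarrow>
     (\<forall>\<alpha>\<in>charts M. smooth_on (\<lambda>x. f (chart_inv M \<alpha> x)) (cmap M \<alpha> ` cdom M \<alpha>))"


section \<open>Tensors\<close>

text \<open>A tangent vector at \<open>p\<close> is the family of its components in the charts around \<open>p\<close>, subject to
  the contravariant transformation law; entries for the other indices are normalised to \<open>0\<close>.\<close>

definition tangent_space ::
    "('p, 'i, 'e::euclidean_space) manifold \<Rightarrow> 'p \<Rightarrow> ('i \<Rightarrow> 'e) set" where
  "tangent_space M p = {v.
     (\<forall>\<alpha>\<in>charts M. \<forall>\<beta>\<in>charts M. p \<in> cdom M \<alpha> \<longrightarrow> p \<in> cdom M \<beta> \<longrightarrow>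
        v \<beta> = frechet_derivative (transition M \<alpha> \<beta>) (at (cmap M \<alpha> p)) (v \<alpha>)) \<and>
     (\<forall>\<alpha>. \<not> (\<alpha> \<in> charts M \<and> p \<in> cdom M \<alpha>) \<longrightarrow> v \<alpha> = 0)}"

definition smooth_vector_field ::
    "('p, 'i, 'e::euclidean_space) manifold \<Rightarrow> ('p \<Rightarrow> 'i \<Rightarrow> 'e) \<Rightarrow> bool" where
  "smooth_vector_field M X \<longleftrightarrow>
     (\<forall>p\<in>topspace (mtop M). X p \<in> tangent_space M p) \<and>
     (\<forall>\<alpha>\<in>charts M. smooth_on (\<lambda>x. X (chart_inv M \<alpha> x) \<alpha>) (cmap M \<alpha> ` cdom M \<alpha>))"

text \<open>Likewise, a covariant 2-tensor field assigns to \<open>p\<close> and each chart \<open>\<alpha>\<close> around \<open>p\<close> a bilinear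
  form on the model space, \<open>G p \<alpha> u w\<close> being the value on the tangent vectors with components
  \<open>u\<close>, \<open>w\<close> in \<open>\<alpha>\<close>.\<close>

type_synonym ('p, 'i, 'e) tensor2 = "'p \<Rightarrow> 'i \<Rightarrow> 'e \<Rightarrow> 'e \<Rightarrow> real"

definition smooth_covariant_tensor2 ::
    "('p, 'i, 'e::euclidean_space) manifold \<Rightarrow> ('p, 'i, 'e) tensor2 \<Rightarrow> bool" where
  "smooth_covariant_tensor2 M G \<longleftrightarrow>
     (\<forall>\<alpha>\<in>charts M. \<forall>p\<in>cdom M \<alpha>. bilinear (G p \<alpha>)) \<and>
     (\<forall>\<alpha>\<in>charts M. \<forall>\<beta>\<in>charts M. \<forall>p\<in>cdom M \<alpha> \<inter> cdom M \<beta>. \<forall>u w.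
        G p \<alpha> u w =
        G p \<beta> (frechet_derivative (transition M \<alpha> \<beta>) (at (cmap M \<alpha> p)) u)
              (frechet_derivative (transition M \<alpha> \<beta>) (at (cmap M \<alpha> p)) w)) \<and>
     (\<forall>\<alpha>\<in>charts M. \<forall>u w.
        smooth_on (\<lambda>x. G (chart_inv M \<alpha> x) \<alpha> u w) (cmap M \<alpha> ` cdom M \<alpha>))"

definition riemannian_metric ::
    "('p, 'i, 'e::euclidean_space) manifold \<Rightarrow> ('p, 'i, 'e) tensor2 \<Rightarrow> bool" where
  "riemannian_metric M g \<longleftrightarrow> smooth_covariant_tensor2 M g \<and>
     (\<forall>\<alpha>\<in>charts M. \<forall>p\<in>cdom M \<alpha>.
        (\<forall>u w. g p \<alpha> u w = g p \<alpha> w u) \<and> (\<forall>u. u \<noteq> 0 \<longrightarrow> g p \<alpha> u u > 0))"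

text \<open>The Lie derivative \<open>\<L>\<^sub>X G\<close> in the chart \<open>\<alpha>\<close>: with constant coefficient fields \<open>u\<close>, \<open>w\<close> this is
  \<open>X\<^sup>C \<partial>\<^sub>C G\<^sub>A\<^sub>B + G\<^sub>C\<^sub>B \<partial>\<^sub>A X\<^sup>C + G\<^sub>A\<^sub>C \<partial>\<^sub>B X\<^sup>C\<close> contracted with \<open>u\<^sup>A w\<^sup>B\<close>.\<close>

definition lie_derivative ::
    "('p, 'i, 'e::euclidean_space) manifold \<Rightarrow> ('p \<Rightarrow> 'i \<Rightarrow> 'e) \<Rightarrow> ('p, 'i, 'e) tensor2 \<Rightarrow>
     ('p, 'i, 'e) tensor2" where
  "lie_derivative M X G p \<alpha> u w =
     (let x = cmap M \<alpha> p;
          DX = frechet_derivative (\<lambda>z. X (chart_inv M \<alpha> z) \<alpha>) (at x)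
      in frechet_derivative (\<lambda>z. G (chart_inv M \<alpha> z) \<alpha> u w) (at x) (X p \<alpha>)
         + G p \<alpha> (DX u) w + G p \<alpha> u (DX w))"

definition conformal_with ::
    "('p, 'i, 'e::euclidean_space) manifold \<Rightarrow> ('p, 'i, 'e) tensor2 \<Rightarrow> ('p \<Rightarrow> 'i \<Rightarrow> 'e) \<Rightarrow>
     ('p \<Rightarrow> real) \<Rightarrow> bool" where
  "conformal_with M G X \<Omega> \<longleftrightarrow> smooth_function M \<Omega> \<and>
     (\<forall>\<alpha>\<in>charts M. \<forall>p\<in>cdom M \<alpha>. \<forall>u w.
        lie_derivative M X G p \<alpha> u w = 2 * \<Omega> p * G p \<alpha> u w)"

definition conformal_vector_field ::
    "('p, 'i, 'e::euclidean_space) manifold \<Rightarrow> ('p, 'i, 'e) tensor2 \<Rightarrow> ('p \<Rightarrow> 'i \<Rightarrow> 'e) \<Rightarrow> bool" where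
  "conformal_vector_field M G X \<longleftrightarrow> (\<exists>\<Omega>. conformal_with M G X \<Omega>)"

definition homothetic_vector_field ::
    "('p, 'i, 'e::euclidean_space) manifold \<Rightarrow> ('p, 'i, 'e) tensor2 \<Rightarrow> ('p \<Rightarrow> 'i \<Rightarrow> 'e) \<Rightarrow> bool" where
  "homothetic_vector_field M G X \<longleftrightarrow>
     (\<exists>\<Omega>. conformal_with M G X \<Omega> \<and> (\<exists>k. \<forall>p\<in>topspace (mtop M). \<Omega> p = k))"

definition killing_vector_field ::
    "('p, 'i, 'e::euclidean_space) manifold \<Rightarrow> ('p, 'i, 'e) tensor2 \<Rightarrow> ('p \<Rightarrow> 'i \<Rightarrow> 'e) \<Rightarrow> bool" where
  "killing_vector_field M G X \<longleftrightarrow>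
     (\<exists>\<Omega>. conformal_with M G X \<Omega> \<and> (\<forall>p\<in>topspace (mtop M). \<Omega> p = 0))"


section \<open>The tangent bundle\<close>

definition tangent_bundle ::
    "('p, 'i, 'e::euclidean_space) manifold \<Rightarrow> ('p \<times> ('i \<Rightarrow> 'e), 'i, 'e \<times> 'e) manifold" where
  "tangent_bundle M =
     (let D = (\<lambda>\<alpha>. {(p, v). p \<in> cdom M \<alpha> \<and> v \<in> tangent_space M p});
          \<phi> = (\<lambda>\<alpha> (p, v). (cmap M \<alpha> p, v \<alpha>))
      in \<lparr> mtop = topology_generated_by {D \<alpha> \<inter> \<phi> \<alpha> -` W | \<alpha> W. \<alpha> \<in> charts M \<and> open W},
           charts = charts M, cdom = D, cmap = \<phi> \<rparr>)"


section \<open>The Levi-Civita connection in coordinates\<close>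

definition metric_matrix ::
    "('p, 'i, real^'n) manifold \<Rightarrow> ('p, 'i, real^'n) tensor2 \<Rightarrow> 'i \<Rightarrow> real^'n \<Rightarrow> real^'n^'n" where
  "metric_matrix M g \<alpha> x = (\<chi> i j. g (chart_inv M \<alpha> x) \<alpha> (axis i 1) (axis j 1))"

text \<open>\<open>christoffel M g \<alpha> x k j i\<close> is \<open>\<Gamma>\<^sub>j\<^sup>k\<^sub>i\<close> (upper index first) at the point with coordinates \<open>x\<close>
  in the chart \<open>\<alpha>\<close>.\<close>

definition christoffel ::
    "('p, 'i, real^'n) manifold \<Rightarrow> ('p, 'i, real^'n) tensor2 \<Rightarrow> 'i \<Rightarrow> real^'n \<Rightarrow>
     'n \<Rightarrow> 'n \<Rightarrow> 'n \<Rightarrow> real" where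
  "christoffel M g \<alpha> x k j i =
     (1 / 2) * (\<Sum>l\<in>UNIV. matrix_inv (metric_matrix M g \<alpha> x) $ k $ l *
       (partial_deriv (\<lambda>z. metric_matrix M g \<alpha> z $ i $ l) j x
        + partial_deriv (\<lambda>z. metric_matrix M g \<alpha> z $ j $ l) i x
        - partial_deriv (\<lambda>z. metric_matrix M g \<alpha> z $ j $ i) l x))"


section \<open>Adapted frame, lifted metrics and lifted vector fields\<close>

text \<open>All components on the tangent bundle refer to the chart induced by \<open>\<alpha>\<close>, with coordinates
  \<open>(x\<^sup>i, y\<^sup>i)\<close>. A point of the tangent bundle is a pair \<open>P = (p, v)\<close>, and its fibre coordinates
  are \<open>y = snd P \<alpha>\<close>.\<close>

definition frame_h ::
    "('p, 'i, real^'n) manifold \<Rightarrow> ('p, 'i, real^'n) tensor2 \<Rightarrow> 'p \<times> ('i \<Rightarrow> real^'n) \<Rightarrow> 'i \<Rightarrow>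
     'n \<Rightarrow> (real^'n) \<times> (real^'n)" where
  "frame_h M g P \<alpha> h =
     (axis h 1,
      \<chi> m. - (\<Sum>a\<in>UNIV. snd P \<alpha> $ a * christoffel M g \<alpha> (cmap M \<alpha> (fst P)) m a h))"

definition frame_v :: "'n \<Rightarrow> (real^'n) \<times> (real^'n)" where
  "frame_v h = (0, axis h 1)"

definition coframe_dx :: "'n \<Rightarrow> (real^'n) \<times> (real^'n) \<Rightarrow> real" where
  "coframe_dx h \<xi> = fst \<xi> $ h"

definition coframe_dy ::
    "('p, 'i, real^'n) manifold \<Rightarrow> ('p, 'i, real^'n) tensor2 \<Rightarrow> 'p \<times> ('i \<Rightarrow> real^'n) \<Rightarrow> 'i \<Rightarrow>
     'n \<Rightarrow> (real^'n) \<times> (real^'n) \<Rightarrow> real" where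
  "coframe_dy M g P \<alpha> h \<xi> = snd \<xi> $ h +
     (\<Sum>a\<in>UNIV. \<Sum>i\<in>UNIV. snd P \<alpha> $ a * christoffel M g \<alpha> (cmap M \<alpha> (fst P)) h a i * fst \<xi> $ i)"

definition metric1 ::
    "('p, 'i, real^'n) manifold \<Rightarrow> ('p, 'i, real^'n) tensor2 \<Rightarrow>
     ('p \<times> ('i \<Rightarrow> real^'n), 'i, (real^'n) \<times> (real^'n)) tensor2" where
  "metric1 M g P \<alpha> \<xi> \<eta> =
     (\<Sum>i\<in>UNIV. \<Sum>j\<in>UNIV. g (fst P) \<alpha> (axis i 1) (axis j 1) * (coframe_dx i \<xi> * coframe_dx j \<eta>))"

text \<open>The product of 1-forms in \<open>g\<^sub>2 = 2 g\<^sub>i\<^sub>j dx\<^sup>i \<delta>y\<^sup>j\<close> is the symmetric one,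
  \<open>2 dx\<^sup>i \<delta>y\<^sup>j = dx\<^sup>i \<otimes> \<delta>y\<^sup>j + \<delta>y\<^sup>j \<otimes> dx\<^sup>i\<close>.\<close>

definition metric2 ::
    "('p, 'i, real^'n) manifold \<Rightarrow> ('p, 'i, real^'n) tensor2 \<Rightarrow>
     ('p \<times> ('i \<Rightarrow> real^'n), 'i, (real^'n) \<times> (real^'n)) tensor2" where
  "metric2 M g P \<alpha> \<xi> \<eta> =
     (\<Sum>i\<in>UNIV. \<Sum>j\<in>UNIV. g (fst P) \<alpha> (axis i 1) (axis j 1) *
        (coframe_dx i \<xi> * coframe_dy M g P \<alpha> j \<eta> + coframe_dy M g P \<alpha> j \<xi> * coframe_dx i \<eta>))"

definition metric3 ::
    "('p, 'i, real^'n) manifold \<Rightarrow> ('p, 'i, real^'n) tensor2 \<Rightarrow>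
     ('p \<times> ('i \<Rightarrow> real^'n), 'i, (real^'n) \<times> (real^'n)) tensor2" where
  "metric3 M g P \<alpha> \<xi> \<eta> =
     (\<Sum>i\<in>UNIV. \<Sum>j\<in>UNIV. g (fst P) \<alpha> (axis i 1) (axis j 1) *
        (coframe_dy M g P \<alpha> i \<xi> * coframe_dy M g P \<alpha> j \<eta>))"

definition lift_metric ::
    "('p, 'i, real^'n) manifold \<Rightarrow> ('p, 'i, real^'n) tensor2 \<Rightarrow> real \<Rightarrow> real \<Rightarrow> real \<Rightarrow>
     ('p \<times> ('i \<Rightarrow> real^'n), 'i, (real^'n) \<times> (real^'n)) tensor2" where
  "lift_metric M g a b c P \<alpha> \<xi> \<eta> =
     a * metric1 M g P \<alpha> \<xi> \<eta> + b * metric2 M g P \<alpha> \<xi> \<eta> + c * metric3 M g P \<alpha> \<xi> \<eta>"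

definition horizontal_lift ::
    "('p, 'i, real^'n) manifold \<Rightarrow> ('p, 'i, real^'n) tensor2 \<Rightarrow> ('p \<Rightarrow> 'i \<Rightarrow> real^'n) \<Rightarrow>
     'p \<times> ('i \<Rightarrow> real^'n) \<Rightarrow> 'i \<Rightarrow> (real^'n) \<times> (real^'n)" where
  "horizontal_lift M g V P \<alpha> = (\<Sum>h\<in>UNIV. (V (fst P) \<alpha> $ h) *\<^sub>R frame_h M g P \<alpha> h)"

definition vertical_lift ::
    "('p \<Rightarrow> 'i \<Rightarrow> real^'n) \<Rightarrow> 'p \<times> ('i \<Rightarrow> real^'n) \<Rightarrow> 'i \<Rightarrow> (real^'n) \<times> (real^'n)" where
  "vertical_lift V P \<alpha> = (\<Sum>h\<in>UNIV. (V (fst P) \<alpha> $ h) *\<^sub>R frame_v h)"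

definition complete_lift ::
    "('p, 'i, real^'n) manifold \<Rightarrow> ('p, 'i, real^'n) tensor2 \<Rightarrow> ('p \<Rightarrow> 'i \<Rightarrow> real^'n) \<Rightarrow>
     'p \<times> ('i \<Rightarrow> real^'n) \<Rightarrow> 'i \<Rightarrow> (real^'n) \<times> (real^'n)" where
  "complete_lift M g V P \<alpha> =
     (let x = cmap M \<alpha> (fst P) in
      (\<Sum>h\<in>UNIV. (V (fst P) \<alpha> $ h) *\<^sub>R frame_h M g P \<alpha> h) +
      (\<Sum>h\<in>UNIV. (\<Sum>m\<in>UNIV. snd P \<alpha> $ m *
         ((\<Sum>a\<in>UNIV. christoffel M g \<alpha> x h m a * V (fst P) \<alpha> $ a)
          + partial_deriv (\<lambda>z. V (chart_inv M \<alpha> z) \<alpha> $ h) m x)) *\<^sub>R frame_v h))"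

lemma coframe_frame:
  "coframe_dx i (frame_h M g P \<alpha> h) = (if i = h then 1 else 0)"
  "coframe_dx i (frame_v h) = 0"
  "coframe_dy M g P \<alpha> i (frame_h M g P \<alpha> h) = 0"
  "coframe_dy M g P \<alpha> i (frame_v h) = (if i = h then 1 else 0)"
  by (simp_all add: coframe_dx_def coframe_dy_def frame_h_def frame_v_def axis_def if_distrib
      cong: if_cong)

lemma sum_delta_delta:
  "(\<Sum>k\<in>UNIV. \<Sum>l\<in>UNIV. f k l * ((if k = i then 1 else 0) * (if l = j then 1 else 0))) = f i j"
  for f :: "'n::finite \<Rightarrow> 'n \<Rightarrow> real"
proof -
  have "f k l * ((if k = i then 1 else 0) * (if l = j then 1 else 0)) =
        (if l = j then (if k = i then f k l else 0) else 0)" for k l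
    by simp
  then show ?thesis by simp
qed

lemma lift_metric_frame:
  "lift_metric M g a b c P \<alpha> (frame_h M g P \<alpha> i) (frame_h M g P \<alpha> j)
     = a * g (fst P) \<alpha> (axis i 1) (axis j 1)"
  "lift_metric M g a b c P \<alpha> (frame_h M g P \<alpha> i) (frame_v j)
     = b * g (fst P) \<alpha> (axis i 1) (axis j 1)"
  "lift_metric M g a b c P \<alpha> (frame_v i) (frame_v j)
     = c * g (fst P) \<alpha> (axis i 1) (axis j 1)"
  unfolding lift_metric_def metric1_def metric2_def metric3_def coframe_frame
    mult_zero_left mult_zero_right add_0_left add_0_right sum_delta_delta
  by simp_all

end

theory Submission
  imports Defs
begin

text \<open>Everything is read off in a chart from the components of \<open>\<L>\<^sub>X G = 2 \<Omega> G\<close> (\<open>G\<close> the lifted metric)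
  with a vertical entry. On two vertical vectors \<open>G\<close> is \<open>c g\<close>, and the left-hand side is \<open>0\<close> for the
  vertical lift, \<open>c \<nabla>\<^sub>V g = 0\<close> for the horizontal lift and \<open>c \<L>\<^sub>V g\<close> for the complete lift. In the
  first two cases \<open>\<Omega> = 0\<close>. For the complete lift, \<open>\<L>\<^sub>V g = 2 \<Omega> g\<close> shows that \<open>\<Omega>\<close> is constant on the
  fibres, and the component on \<open>\<partial>/\<partial>y\<^sup>u\<close> and \<open>\<partial>/\<partial>x\<^sup>w\<close> then says that \<open>V\<close> is affine, \<open>\<L>\<^sub>V \<Gamma> = 0\<close>.
  Differentiating \<open>\<L>\<^sub>V g = 2 \<Omega> g\<close>, using that \<open>V\<close> is affine and that second derivatives of \<open>g\<close>
  commute, leaves \<open>d\<Omega> = 0\<close>, and \<open>M\<close> is connected.\<close>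

section \<open>Calculus in Euclidean spaces\<close>

abbreviation fderiv :: "('a::real_normed_vector \<Rightarrow> 'b::real_normed_vector) \<Rightarrow> 'a \<Rightarrow> 'a \<Rightarrow> 'b" where
  "fderiv f x \<equiv> frechet_derivative f (at x)"

lemma fderiv_eq: "(f has_derivative f') (at x) \<Longrightarrow> fderiv f x v = f' v"
  using frechet_derivative_at by metis

lemma smooth_on_imp_differentiable: "smooth_on f S \<Longrightarrow> x \<in> S \<Longrightarrow> f differentiable (at x)"
  unfolding smooth_on_def by (metis Ck_on.simps(2))

lemma smooth_on_imp_has_derivative: "smooth_on f S \<Longrightarrow> x \<in> S \<Longrightarrow> (f has_derivative fderiv f x) (at x)"
  using smooth_on_imp_differentiable frechet_derivative_works by blast

lemma smooth_on_fderiv: "smooth_on f S \<Longrightarrow> smooth_on (\<lambda>x. fderiv f x v) S"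
  unfolding smooth_on_def by (metis Ck_on.simps(2))

lemma smooth_on_imp_continuous_on: "smooth_on f S \<Longrightarrow> continuous_on S f"
  unfolding smooth_on_def by (metis Ck_on.simps(1))

section \<open>Symmetry of second derivatives\<close>

lemma has_field_derivative_along_line:
  fixes f :: "'e::real_normed_vector \<Rightarrow> real"
  assumes "f differentiable (at (p + s *\<^sub>R v))"
  shows "((\<lambda>s. f (p + s *\<^sub>R v)) has_field_derivative fderiv f (p + s *\<^sub>R v) v) (at s)"
proof -
  have f: "(f has_derivative fderiv f (p + s *\<^sub>R v)) (at (p + s *\<^sub>R v))"
    using assms frechet_derivative_works by blast
  have "((\<lambda>s. f (p + s *\<^sub>R v)) has_derivative (\<lambda>h. fderiv f (p + s *\<^sub>R v) (h *\<^sub>R v))) (at s)"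
    by (rule has_derivative_compose[where g=f and f="\<lambda>s. p + s *\<^sub>R v"])
      (auto intro!: derivative_eq_intros f)
  moreover have "fderiv f (p + s *\<^sub>R v) (h *\<^sub>R v) = h * fderiv f (p + s *\<^sub>R v) v" for h
    using linear_frechet_derivative[OF assms] by (simp add: linear_cmul)
  ultimately show ?thesis
    by (simp add: has_field_derivative_def mult.commute[of _ "fderiv _ _ _"])
qed

text \<open>Two mean value theorems: one along \<open>v\<close> for the increment of
  \<open>f\<close> by \<open>t *\<^sub>R w\<close>, then one along \<open>w\<close> for the
  resulting derivative of \<open>f\<close> along \<open>v\<close>. The second difference is
  symmetric in \<open>v\<close> and \<open>w\<close>, which is what the next lemma exploits.\<close>

lemma second_difference:
  fixes f :: "'e::euclidean_space \<Rightarrow> real"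
  assumes f: "smooth_on f S" and "t > 0"
    and S: "\<And>s r. 0 \<le> s \<Longrightarrow> s \<le> t \<Longrightarrow> 0 \<le> r \<Longrightarrow> r \<le> t \<Longrightarrow> x + s *\<^sub>R v + r *\<^sub>R w \<in> S"
  obtains s r where "0 < s" "s < t" "0 < r" "r < t"
    "f (x + t *\<^sub>R v + t *\<^sub>R w) - f (x + t *\<^sub>R v) - f (x + t *\<^sub>R w) + f x =
      t * t * fderiv (\<lambda>z. fderiv f z v) (x + s *\<^sub>R v + r *\<^sub>R w) w"
proof -
  have "\<exists>s>0. s < t \<and> (f (x + t *\<^sub>R v + t *\<^sub>R w) - f (x + t *\<^sub>R v)) - (f (x + 0 *\<^sub>R v + t *\<^sub>R w) - f (x + 0 *\<^sub>R v)) =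
      (t - 0) * (fderiv f (x + s *\<^sub>R v + t *\<^sub>R w) v - fderiv f (x + s *\<^sub>R v) v)"
  proof (rule MVT2[OF \<open>t > 0\<close>])
    fix s assume s: "0 \<le> s" "s \<le> t"
    have 1: "f differentiable at ((x + t *\<^sub>R w) + s *\<^sub>R v)"
      using S[of s t] s \<open>t > 0\<close> by (intro smooth_on_imp_differentiable[OF f]) (simp add: algebra_simps)
    have 2: "f differentiable at (x + s *\<^sub>R v)"
      using S[of s 0] s \<open>t > 0\<close> by (intro smooth_on_imp_differentiable[OF f]) (simp add: algebra_simps)
    show "((\<lambda>s. f (x + s *\<^sub>R v + t *\<^sub>R w) - f (x + s *\<^sub>R v)) has_real_derivative
        fderiv f (x + s *\<^sub>R v + t *\<^sub>R w) v - fderiv f (x + s *\<^sub>R v) v) (at s)"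
      using DERIV_diff[OF has_field_derivative_along_line[OF 1] has_field_derivative_along_line[OF 2]]
      by (simp add: algebra_simps)
  qed
  then obtain s where s: "0 < s" "s < t" and
    *: "(f (x + t *\<^sub>R v + t *\<^sub>R w) - f (x + t *\<^sub>R v)) - (f (x + t *\<^sub>R w) - f x) =
      t * (fderiv f (x + s *\<^sub>R v + t *\<^sub>R w) v - fderiv f (x + s *\<^sub>R v) v)" by auto
  have "\<exists>r>0. r < t \<and> fderiv f (x + s *\<^sub>R v + t *\<^sub>R w) v - fderiv f (x + s *\<^sub>R v + 0 *\<^sub>R w) v =
      (t - 0) * fderiv (\<lambda>z. fderiv f z v) (x + s *\<^sub>R v + r *\<^sub>R w) w"
  proof (rule MVT2[OF \<open>t > 0\<close>])
    fix r assume r: "0 \<le> r" "r \<le> t"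
    show "((\<lambda>r. fderiv f (x + s *\<^sub>R v + r *\<^sub>R w) v) has_real_derivative
        fderiv (\<lambda>z. fderiv f z v) (x + s *\<^sub>R v + r *\<^sub>R w) w) (at r)"
      by (rule has_field_derivative_along_line[where f="\<lambda>z. fderiv f z v"])
        (use s r S[of s r] smooth_on_imp_differentiable[OF smooth_on_fderiv[OF f]] in auto)
  qed
  then obtain r where r: "0 < r" "r < t" and
    "fderiv f (x + s *\<^sub>R v + t *\<^sub>R w) v - fderiv f (x + s *\<^sub>R v) v =
      t * fderiv (\<lambda>z. fderiv f z v) (x + s *\<^sub>R v + r *\<^sub>R w) w" by auto
  with * have "f (x + t *\<^sub>R v + t *\<^sub>R w) - f (x + t *\<^sub>R v) - f (x + t *\<^sub>R w) + f x =
      t * t * fderiv (\<lambda>z. fderiv f z v) (x + s *\<^sub>R v + r *\<^sub>R w) w"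
    by (simp add: algebra_simps)
  with s r that show ?thesis by blast
qed

text \<open>Clairaut's theorem. The same second difference, read in both orders, makes the two mixed
  derivatives agree at points as close to \<open>x\<close> as desired. Since both are continuous,
  they cannot differ at \<open>x\<close>.\<close>

lemma second_fderiv_commute:
  fixes f :: "'e::euclidean_space \<Rightarrow> real"
  assumes f: "smooth_on f S" and "open S" "x \<in> S"
  shows "fderiv (\<lambda>z. fderiv f z v) x w = fderiv (\<lambda>z. fderiv f z w) x v"
proof (rule ccontr)
  let ?F = "\<lambda>v w z. fderiv (\<lambda>z. fderiv f z v) z w"
  assume neq: "?F v w x \<noteq> ?F w v x"
  \<comment> \<open>Half the supposed gap: values within \<open>e\<close> of the two mixed
    derivatives at \<open>x\<close> can never coincide.\<close>
  define e where "e = \<bar>?F v w x - ?F w v x\<bar> / 2"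
  have "e > 0" using neq by (simp add: e_def)
  have near: "\<exists>d>0. \<forall>z. dist z x < d \<longrightarrow> z \<in> S \<and> \<bar>?F v w z - ?F v w x\<bar> < e" for v w
  proof -
    have "continuous_on S (?F v w)"
      by (intro smooth_on_imp_continuous_on smooth_on_fderiv f)
    then have "continuous (at x) (?F v w)"
      using assms continuous_on_eq_continuous_at by blast
    then obtain d1 where d1: "d1 > 0" "\<And>z. dist z x < d1 \<Longrightarrow> \<bar>?F v w z - ?F v w x\<bar> < e"
      unfolding continuous_at_eps_delta using \<open>e > 0\<close> by (auto simp: dist_real_def)
    obtain d2 where d2: "d2 > 0" "ball x d2 \<subseteq> S"
      using assms open_contains_ball by blast
    from d1 d2 show ?thesis
      by (intro exI[of _ "min d1 d2"]) (auto simp: subset_eq dist_commute)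
  qed
  obtain d1 where d1: "d1 > 0" "\<And>z. dist z x < d1 \<Longrightarrow> z \<in> S \<and> \<bar>?F v w z - ?F v w x\<bar> < e"
    using near by blast
  obtain d2 where d2: "d2 > 0" "\<And>z. dist z x < d2 \<Longrightarrow> z \<in> S \<and> \<bar>?F w v z - ?F w v x\<bar> < e"
    using near by blast
  \<comment> \<open>The parallelogram at \<open>x\<close> with sides \<open>t *\<^sub>R v\<close>
    and \<open>t *\<^sub>R w\<close> then stays within both radii. The summand 1 keeps the
    denominator positive even if \<open>v\<close> and \<open>w\<close> vanish.\<close>
  define t where "t = min d1 d2 / (norm v + norm w + 1)"
  have pos: "norm v + norm w + 1 > 0" by (simp add: add_nonneg_pos)
  have "t > 0" using d1 d2 pos by (simp add: t_def)
  have small: "dist (x + s *\<^sub>R v + r *\<^sub>R w) x < min d1 d2"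
    if "0 \<le> s" "s \<le> t" "0 \<le> r" "r \<le> t" for s r
  proof -
    have "dist (x + s *\<^sub>R v + r *\<^sub>R w) x = norm (s *\<^sub>R v + r *\<^sub>R w)"
      by (simp add: dist_norm algebra_simps)
    also have "\<dots> \<le> s * norm v + r * norm w"
      using that by (intro order_trans[OF norm_triangle_ineq]) simp
    also have "\<dots> \<le> t * norm v + t * norm w"
      using that by (intro add_mono mult_right_mono) auto
    also have "\<dots> < t * (norm v + norm w + 1)"
      using \<open>t > 0\<close> by (simp add: algebra_simps)
    also have "\<dots> = min d1 d2" using pos by (simp add: t_def)
    finally show ?thesis .
  qed
  have small': "dist (x + r *\<^sub>R w + s *\<^sub>R v) x < min d1 d2"
    if "0 \<le> s" "s \<le> t" "0 \<le> r" "r \<le> t" for s r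
    using small[OF that] by (simp add: algebra_simps)
  obtain s r where 1: "0 < s" "s < t" "0 < r" "r < t"
    "f (x + t *\<^sub>R v + t *\<^sub>R w) - f (x + t *\<^sub>R v) - f (x + t *\<^sub>R w) + f x = t * t * ?F v w (x + s *\<^sub>R v + r *\<^sub>R w)"
    by (rule second_difference[OF f \<open>t > 0\<close>, of x v w]) (use small d1 in auto)
  obtain s' r' where 2: "0 < s'" "s' < t" "0 < r'" "r' < t"
    "f (x + t *\<^sub>R w + t *\<^sub>R v) - f (x + t *\<^sub>R w) - f (x + t *\<^sub>R v) + f x = t * t * ?F w v (x + s' *\<^sub>R w + r' *\<^sub>R v)"
    by (rule second_difference[OF f \<open>t > 0\<close>, of x w v]) (use small' d1 in auto)
  have "t * t * ?F v w (x + s *\<^sub>R v + r *\<^sub>R w) = t * t * ?F w v (x + s' *\<^sub>R w + r' *\<^sub>R v)"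
    unfolding 1(5)[symmetric] 2(5)[symmetric] by (simp add: algebra_simps)
  then have "?F v w (x + s *\<^sub>R v + r *\<^sub>R w) = ?F w v (x + s' *\<^sub>R w + r' *\<^sub>R v)"
    using \<open>t > 0\<close> by simp
  moreover have "\<bar>?F v w (x + s *\<^sub>R v + r *\<^sub>R w) - ?F v w x\<bar> < e"
    using d1(2) small[of s r] 1 by simp
  moreover have "\<bar>?F w v (x + s' *\<^sub>R w + r' *\<^sub>R v) - ?F w v x\<bar> < e"
    using d2(2) small'[of r' s'] 2 by simp
  ultimately show False unfolding e_def by (simp add: abs_if split: if_splits)
qed

section \<open>Product rule for families of linear maps\<close>

text \<open>Expanding the argument in the finite basis reduces \<open>B z (A z)\<close> to a finite
  sum of products. Hence differentiability of \<open>B\<close> for each fixed vector suffices, and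
  the first term of the derivative keeps the argument frozen at \<open>A x\<close>.\<close>

lemma has_derivative_linear_family:
  fixes B :: "'z::real_normed_vector \<Rightarrow> 'e::euclidean_space \<Rightarrow> 'b::real_normed_vector"
  assumes "open U" "x \<in> U" and lin: "\<And>z. z \<in> U \<Longrightarrow> linear (B z)"
    and B: "\<And>v. (\<lambda>z. B z v) differentiable (at x)" and A: "(A has_derivative A') (at x)"
  shows "((\<lambda>z. B z (A z)) has_derivative (\<lambda>k. fderiv (\<lambda>z. B z (A x)) x k + B x (A' k))) (at x)"
proof -
  have expand: "B z u = (\<Sum>i\<in>Basis. (u \<bullet> i) *\<^sub>R B z i)" if "z \<in> U" for z u
  proof -
    have "B z u = B z (\<Sum>i\<in>Basis. (u \<bullet> i) *\<^sub>R i)" by (simp add: euclidean_representation)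
    then show ?thesis using lin[OF that] by (simp add: linear_sum linear_cmul)
  qed
  have Bi: "((\<lambda>z. B z v) has_derivative fderiv (\<lambda>z. B z v) x) (at x)" for v
    using B frechet_derivative_works by blast
  have "((\<lambda>z. \<Sum>i\<in>Basis. (A x \<bullet> i) *\<^sub>R B z i) has_derivative
      (\<lambda>k. \<Sum>i\<in>Basis. (A x \<bullet> i) *\<^sub>R fderiv (\<lambda>z. B z i) x k)) (at x)"
    by (intro has_derivative_sum has_derivative_scaleR_right Bi)
  then have "((\<lambda>z. B z (A x)) has_derivative
      (\<lambda>k. \<Sum>i\<in>Basis. (A x \<bullet> i) *\<^sub>R fderiv (\<lambda>z. B z i) x k)) (at x)"
    by (rule has_derivative_transform_within_open[OF _ \<open>open U\<close> \<open>x \<in> U\<close>]) (rule expand[symmetric])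
  then have 1: "fderiv (\<lambda>z. B z (A x)) x k = (\<Sum>i\<in>Basis. (A x \<bullet> i) *\<^sub>R fderiv (\<lambda>z. B z i) x k)" for k
    by (rule fderiv_eq)
  have "((\<lambda>z. \<Sum>i\<in>Basis. (A z \<bullet> i) *\<^sub>R B z i) has_derivative
      (\<lambda>k. \<Sum>i\<in>Basis. (A x \<bullet> i) *\<^sub>R fderiv (\<lambda>z. B z i) x k + (A' k \<bullet> i) *\<^sub>R B x i)) (at x)"
    by (intro has_derivative_sum has_derivative_scaleR Bi has_derivative_inner_left A)
  moreover have "(\<lambda>k. \<Sum>i\<in>Basis. (A x \<bullet> i) *\<^sub>R fderiv (\<lambda>z. B z i) x k + (A' k \<bullet> i) *\<^sub>R B x i) =
      (\<lambda>k. fderiv (\<lambda>z. B z (A x)) x k + B x (A' k))"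
    unfolding 1 expand[OF \<open>x \<in> U\<close>, of "A' _"] by (simp add: sum.distrib)
  ultimately show ?thesis
    by (auto intro: has_derivative_transform_within_open[OF _ \<open>open U\<close> \<open>x \<in> U\<close>] expand[symmetric])
qed

lemma differentiable_linear_family:
  fixes B :: "'z::real_normed_vector \<Rightarrow> 'e::euclidean_space \<Rightarrow> 'b::real_normed_vector"
  assumes "open U" "x \<in> U" "\<And>z. z \<in> U \<Longrightarrow> linear (B z)"
    and "\<And>v. (\<lambda>z. B z v) differentiable (at x)" and "A differentiable (at x)"
  shows "(\<lambda>z. B z (A z)) differentiable (at x)"
  using has_derivative_linear_family[OF assms(1-4), of A] assms(5)
  unfolding differentiable_def by blast

section \<open>Determinants and inverse matrices depending on a parameter\<close>

lemma differentiable_prod: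
  fixes f :: "'a \<Rightarrow> 'e::real_normed_vector \<Rightarrow> real"
  assumes "\<And>i. i \<in> I \<Longrightarrow> f i differentiable (at x)"
  shows "(\<lambda>z. \<Prod>i\<in>I. f i z) differentiable (at x)"
  using assms by (induction I rule: infinite_finite_induct) auto

lemma differentiable_det:
  fixes F :: "'e::real_normed_vector \<Rightarrow> real^'n^'n"
  assumes "\<And>i j. (\<lambda>z. F z $ i $ j) differentiable (at x)"
  shows "(\<lambda>z. det (F z)) differentiable (at x)"
  unfolding det_def
  by (intro differentiable_sum ballI differentiable_mult differentiable_prod differentiable_const assms) auto

lemma differentiable_componentwise_vec:
  fixes f :: "'e::real_normed_vector \<Rightarrow> real^'n"
  assumes "\<And>i. (\<lambda>z. f z $ i) differentiable (at x)"
  shows "f differentiable (at x)"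
proof -
  have "(\<lambda>z. f z $ i) differentiable (at x)" for i by fact
  then obtain f' where "\<And>i. ((\<lambda>z. f z $ i) has_derivative f' i) (at x)"
    unfolding differentiable_def by metis
  then have "(f has_derivative (\<lambda>v. \<chi> i. f' i v)) (at x)"
    by (subst has_derivative_componentwise_within)
       (auto simp: Basis_vec_def inner_axis)
  then show ?thesis unfolding differentiable_def by blast
qed

lemma matrix_inv_mult:
  fixes A :: "real^'n^'n"
  assumes "det A \<noteq> 0"
  shows "A *v (matrix_inv A *v q) = q"
proof -
  have "\<exists>B. A ** B = mat 1 \<and> B ** A = mat 1"
    using assms invertible_det_nz invertible_def by blast
  then have "A ** matrix_inv A = mat 1"
    unfolding matrix_inv_def by (rule someI2_ex) blast
  then show ?thesis by (simp add: matrix_vector_mul_assoc)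
qed

text \<open>Cramer's rule: each component is a quotient of determinants, the numerator having column
  \<open>k\<close> of \<open>F z\<close> replaced by \<open>q z\<close>, and determinants are
  polynomials in the entries.\<close>

lemma differentiable_matrix_inv_mult:
  fixes F :: "'e::real_normed_vector \<Rightarrow> real^'n^'n" and q :: "'e \<Rightarrow> real^'n"
  assumes "open U" "x \<in> U" and det: "\<And>z. z \<in> U \<Longrightarrow> det (F z) \<noteq> 0"
    and F: "\<And>i j. (\<lambda>z. F z $ i $ j) differentiable (at x)"
    and q: "\<And>i. (\<lambda>z. q z $ i) differentiable (at x)"
  shows "(\<lambda>z. matrix_inv (F z) *v q z) differentiable (at x)"
proof -
  let ?N = "\<lambda>k z. \<chi> i j. if j = k then q z $ i else F z $ i $ j"
  have eq: "(\<chi> k. det (?N k z) / det (F z)) = matrix_inv (F z) *v q z" if "z \<in> U" for z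
    using cramer[OF det[OF that], THEN iffD1, OF matrix_inv_mult[OF det[OF that]]] by (rule sym)
  have "(\<lambda>z. \<chi> k. det (?N k z) / det (F z)) differentiable (at x)"
  proof (rule differentiable_componentwise_vec, simp, rule differentiable_divide)
    fix k show "(\<lambda>z. det (?N k z)) differentiable (at x)"
    proof (rule differentiable_det)
      fix i j show "(\<lambda>z. ?N k z $ i $ j) differentiable (at x)"
        using F q by (cases "j = k") auto
    qed
  qed (use differentiable_det[OF F] det assms in auto)
  then obtain D where "((\<lambda>z. \<chi> k. det (?N k z) / det (F z)) has_derivative D) (at x)"
    unfolding differentiable_def by blast
  then have "((\<lambda>z. matrix_inv (F z) *v q z) has_derivative D) (at x)"
    by (rule has_derivative_transform_within_open[OF _ assms(1,2)]) (rule eq)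
  then show ?thesis unfolding differentiable_def by blast
qed

lemma has_derivative_compose_fst:
  assumes "f differentiable (at x)"
  shows "((\<lambda>p. f (fst p)) has_derivative (\<lambda>k. fderiv f x (fst k))) (at (x, y))"
proof (rule has_derivative_compose[where f=fst and g=f])
  show "(fst has_derivative fst) (at (x, y))"
    by (auto intro!: derivative_eq_intros)
  show "(f has_derivative fderiv f x) (at (fst (x, y)))"
    using assms frechet_derivative_works by auto
qed

lemma linear_axis_expansion:
  fixes f :: "real^'n \<Rightarrow> 'b::real_vector"
  assumes "linear f"
  shows "f u = (\<Sum>i\<in>UNIV. u $ i *\<^sub>R f (axis i 1))"
proof -
  have "f u = f (\<Sum>i\<in>UNIV. u $ i *\<^sub>R axis i 1)"
    using basis_expansion[of u] by (simp add: scalar_mult_eq_scaleR)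
  then show ?thesis using assms by (simp add: linear_sum linear_cmul)
qed

text \<open>For functions on the bundle that are linear in the fibre coordinate. It is the product
  rule on \<open>U \<times> UNIV\<close>, with a family depending on the base coordinate only and
  with \<open>snd\<close> as argument.\<close>

lemma has_derivative_linear_family_prod:
  fixes B :: "'z::real_normed_vector \<Rightarrow> 'e::euclidean_space \<Rightarrow> 'b::real_normed_vector"
  assumes U: "open U" "x \<in> U" and lin: "\<And>z. z \<in> U \<Longrightarrow> linear (B z)"
    and B: "\<And>v. (\<lambda>z. B z v) differentiable (at x)"
  shows "((\<lambda>p. B (fst p) (snd p)) has_derivative
      (\<lambda>k. fderiv (\<lambda>z. B z y) x (fst k) + B x (snd k))) (at (x, y))"
proof -
  note fst = has_derivative_compose_fst[OF B]
  have "((\<lambda>p. B (fst p) (snd p)) has_derivative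
      (\<lambda>k. fderiv (\<lambda>p. B (fst p) (snd (x, y))) (x, y) k + B (fst (x, y)) (snd k))) (at (x, y))"
  proof (rule has_derivative_linear_family[where U="U \<times> UNIV" and B="\<lambda>p. B (fst p)" and A=snd and A'=snd])
    show "(\<lambda>p. B (fst p) v) differentiable at (x, y)" for v
      using fst[of v] by (auto simp: differentiable_def)
  qed (use U lin in \<open>auto intro!: open_Times derivative_eq_intros\<close>)
  moreover have "fderiv (\<lambda>p. B (fst p) y) (x, y) k = fderiv (\<lambda>z. B z y) x (fst k)" for k
    by (rule fderiv_eq[OF fst])
  ultimately show ?thesis by simp
qed

section \<open>Lifts over an open subset of Euclidean space\<close>

text \<open>The formula of \<open>lie_derivative\<close> detached from the atlas, so that it serves
  both for \<open>V\<close> and \<open>g\<close> on \<open>U\<close> and for the lifts on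
  \<open>U \<times> UNIV\<close>.\<close>

definition lie_deriv :: "('e::euclidean_space \<Rightarrow> 'e) \<Rightarrow> ('e \<Rightarrow> 'e \<Rightarrow> 'e \<Rightarrow> real) \<Rightarrow> 'e \<Rightarrow> 'e \<Rightarrow> 'e \<Rightarrow> real" where
  "lie_deriv X G z u w =
    fderiv (\<lambda>p. G p u w) z (X z) + G z (fderiv X z u) w + G z u (fderiv X z w)"

text \<open>\<open>frechet_derivative\<close> is a choice among the derivatives at the point.
  Functions agreeing near \<open>z\<close> have the same derivatives there, so the choice is the
  same even if there are none.\<close>

lemma fderiv_cong_open:
  assumes "open W" "z \<in> W" "\<And>p. p \<in> W \<Longrightarrow> f p = f' p"
  shows "fderiv f z = fderiv f' z"
proof -
  have "(f has_derivative D) (at z) \<longleftrightarrow> (f' has_derivative D) (at z)" for D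
    using assms by (auto intro: has_derivative_transform_within_open[OF _ assms(1,2)])
  then show ?thesis unfolding frechet_derivative_def by simp
qed

lemma lie_deriv_cong:
  assumes "open W" "z \<in> W" and X: "\<And>p. p \<in> W \<Longrightarrow> X p = X' p"
    and G: "\<And>p u w. p \<in> W \<Longrightarrow> G p u w = G' p u w"
  shows "lie_deriv X G z u w = lie_deriv X' G' z u w"
proof -
  have "fderiv X z = fderiv X' z" by (rule fderiv_cong_open) fact+
  moreover have "fderiv (\<lambda>p. G p u w) z = fderiv (\<lambda>p. G' p u w) z"
    by (rule fderiv_cong_open) (fact | rule G)+
  ultimately show ?thesis using assms unfolding lie_deriv_def by simp
qed

text \<open>The metric as seen in a single chart, with \<open>U\<close> the set of coordinates. The
  manifold returns only in \<open>riemannian_chart\<close>.\<close>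

locale metric_on_open =
  fixes U :: "(real^'n) set" and g :: "real^'n \<Rightarrow> real^'n \<Rightarrow> real^'n \<Rightarrow> real"
  assumes open_U: "open U"
    and bilinear_g: "x \<in> U \<Longrightarrow> bilinear (g x)"
    and g_commute: "x \<in> U \<Longrightarrow> g x u w = g x w u"
    and g_pos: "x \<in> U \<Longrightarrow> u \<noteq> 0 \<Longrightarrow> g x u u > 0"
    and smooth_g: "smooth_on (\<lambda>x. g x u w) U"
begin

lemma linear_g_left: "x \<in> U \<Longrightarrow> linear (\<lambda>u. g x u w)"
  and linear_g_right: "x \<in> U \<Longrightarrow> linear (\<lambda>w. g x u w)"
  using bilinear_g by (auto simp: bilinear_def)

lemma differentiable_g: "x \<in> U \<Longrightarrow> (\<lambda>z. g z u w) differentiable (at x)"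
  using smooth_g smooth_on_imp_differentiable by blast

lemma linear_fderiv_g: "x \<in> U \<Longrightarrow> linear (fderiv (\<lambda>z. g z u w) x)"
  using differentiable_g linear_frechet_derivative by blast

lemma fderiv_g_commute: "x \<in> U \<Longrightarrow> fderiv (\<lambda>z. g z u w) x = fderiv (\<lambda>z. g z w u) x"
  by (rule fderiv_cong_open[OF open_U]) (auto simp: g_commute)

lemma linear_fderiv_g_left:
  assumes "x \<in> U"
  shows "linear (\<lambda>u. fderiv (\<lambda>z. g z u w) x k)"
proof (rule linearI)
  have d: "((\<lambda>z. g z u w) has_derivative fderiv (\<lambda>z. g z u w) x) (at x)" for u
    using differentiable_g[OF assms] frechet_derivative_works by blast
  fix u1 u2 r
  have "((\<lambda>z. g z (u1 + u2) w) has_derivative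
      (\<lambda>k. fderiv (\<lambda>z. g z u1 w) x k + fderiv (\<lambda>z. g z u2 w) x k)) (at x)"
    by (rule has_derivative_transform_within_open[OF has_derivative_add[OF d d] open_U assms])
      (use bilinear_g in \<open>simp add: bilinear_ladd\<close>)
  then show "fderiv (\<lambda>z. g z (u1 + u2) w) x k = fderiv (\<lambda>z. g z u1 w) x k + fderiv (\<lambda>z. g z u2 w) x k"
    by (rule fderiv_eq)
  have "((\<lambda>z. g z (r *\<^sub>R u1) w) has_derivative (\<lambda>k. r *\<^sub>R fderiv (\<lambda>z. g z u1 w) x k)) (at x)"
    by (rule has_derivative_transform_within_open[OF has_derivative_scaleR_right[OF d] open_U assms])
      (use bilinear_g in \<open>simp add: bilinear_lmul\<close>)
  then show "fderiv (\<lambda>z. g z (r *\<^sub>R u1) w) x k = r *\<^sub>R fderiv (\<lambda>z. g z u1 w) x k"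
    by (rule fderiv_eq)
qed

lemma linear_fderiv_g_right: "x \<in> U \<Longrightarrow> linear (\<lambda>w. fderiv (\<lambda>z. g z u w) x k)"
  using linear_fderiv_g_left[of x u k] fderiv_g_commute[of x u] by simp

text \<open>The Christoffel symbols of the first kind, \<open>g(u, \<Gamma>(y, w))\<close>. In the chart computations they
  replace the symbols of the second kind wherever possible, so that the inverse of the metric need
  not be differentiated.\<close>

definition christoffel1 :: "real^'n \<Rightarrow> real^'n \<Rightarrow> real^'n \<Rightarrow> real^'n \<Rightarrow> real" where
  "christoffel1 x u y w =
    (fderiv (\<lambda>z. g z w u) x y + fderiv (\<lambda>z. g z y u) x w - fderiv (\<lambda>z. g z y w) x u) / 2"

lemma christoffel1_commute: "x \<in> U \<Longrightarrow> christoffel1 x u y w = christoffel1 x u w y"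
  unfolding christoffel1_def using fderiv_g_commute by simp

text \<open>This is \<nabla>g = 0 with lowered indices: in the sum of the two symbols all
  derivatives of \<open>g\<close> cancel except those along \<open>k\<close>.\<close>

lemma fderiv_g_christoffel1:
  "x \<in> U \<Longrightarrow> fderiv (\<lambda>z. g z u w) x k = christoffel1 x w k u + christoffel1 x u k w"
  unfolding christoffel1_def
  by (simp add: fderiv_g_commute[of x w u] fderiv_g_commute[of x w k] fderiv_g_commute[of x u k] field_simps)

lemma linear_christoffel1:
  assumes "x \<in> U"
  shows "linear (\<lambda>u. christoffel1 x u y w)" "linear (\<lambda>y. christoffel1 x u y w)"
    "linear (\<lambda>w. christoffel1 x u y w)"
proof -
  have *: "christoffel1 x u y w = (1 / 2) *\<^sub>R
      (fderiv (\<lambda>z. g z w u) x y + fderiv (\<lambda>z. g z y u) x w - fderiv (\<lambda>z. g z y w) x u)" for u y w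
    by (simp add: christoffel1_def)
  note linears = linear_compose_scale_right linear_compose_sub linear_compose_add
    linear_fderiv_g[OF assms] linear_fderiv_g_left[OF assms] linear_fderiv_g_right[OF assms]
  show "linear (\<lambda>u. christoffel1 x u y w)" "linear (\<lambda>y. christoffel1 x u y w)"
    "linear (\<lambda>w. christoffel1 x u y w)"
    unfolding * by (intro linears)+
qed

lemma differentiable_christoffel1: "x \<in> U \<Longrightarrow> (\<lambda>z. christoffel1 z u y w) differentiable (at x)"
  unfolding christoffel1_def
  by (intro differentiable_divide differentiable_diff differentiable_add
      smooth_on_imp_differentiable[OF smooth_on_fderiv[OF smooth_g]] differentiable_const) auto

section \<open>The Gram matrix and the Christoffel symbols of the second kind\<close>

definition gram :: "real^'n \<Rightarrow> real^'n^'n" where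
  "gram x = (\<chi> i j. g x (axis i 1) (axis j 1))"

lemma g_eq_gram: "x \<in> U \<Longrightarrow> g x u w = u \<bullet> (gram x *v w)"
proof -
  assume x: "x \<in> U"
  have "g x u w = (\<Sum>i\<in>UNIV. u $ i *\<^sub>R g x (axis i 1) w)"
    by (rule linear_axis_expansion[OF linear_g_left[OF x]])
  also have "\<dots> = (\<Sum>i\<in>UNIV. u $ i *\<^sub>R (\<Sum>j\<in>UNIV. w $ j *\<^sub>R g x (axis i 1) (axis j 1)))"
    by (intro sum.cong refl arg_cong2[where f=scaleR] linear_axis_expansion[OF linear_g_right[OF x]])
  finally show ?thesis
    by (simp add: gram_def inner_vec_def matrix_vector_mult_def sum_distrib_left mult_ac)
qed

text \<open>A vector \<open>w\<close> in the kernel of the Gram matrix satisfies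
  \<open>g x w w = 0\<close>, so it vanishes by positive definiteness.\<close>

lemma det_gram: "x \<in> U \<Longrightarrow> det (gram x) \<noteq> 0"
proof -
  assume x: "x \<in> U"
  have "w = 0" if "gram x *v w = 0" for w
    using g_eq_gram[OF x, of w w] g_pos[OF x, of w] that by force
  then have "invertible (gram x)"
    using matrix_left_invertible_ker invertible_left_inverse by metis
  then show ?thesis using invertible_det_nz by blast
qed

text \<open>The vector \<Gamma>(y, w), with components \<Gamma> contracted with \<open>y\<close> in
  its first lower slot and with \<open>w\<close> in its second. It is obtained by raising the index
  of the first-kind symbol.\<close>

definition christoffel2 :: "real^'n \<Rightarrow> real^'n \<Rightarrow> real^'n \<Rightarrow> real^'n" where
  "christoffel2 x y w = matrix_inv (gram x) *v (\<chi> l. christoffel1 x (axis l 1) y w)"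

lemma g_christoffel2:
  assumes "x \<in> U"
  shows "g x u (christoffel2 x y w) = christoffel1 x u y w"
proof -
  have "christoffel1 x u y w = (\<Sum>l\<in>UNIV. u $ l *\<^sub>R christoffel1 x (axis l 1) y w)"
    by (rule linear_axis_expansion[OF linear_christoffel1(1)[OF assms]])
  then show ?thesis
    by (simp add: g_eq_gram[OF assms] christoffel2_def matrix_inv_mult[OF det_gram[OF assms]] inner_vec_def)
qed

lemma linear_christoffel2:
  assumes "x \<in> U"
  shows "linear (\<lambda>y. christoffel2 x y w)" "linear (\<lambda>w. christoffel2 x y w)"
proof -
  have "linear (\<lambda>y. \<chi> l. christoffel1 x (axis l 1) y w)" "linear (\<lambda>w. \<chi> l. christoffel1 x (axis l 1) y w)"
    using linear_christoffel1[OF assms]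
    by (auto intro!: linearI simp: vec_eq_iff linear_iff)
  from this[THEN linear_compose, OF matrix_vector_mul_linear, of "matrix_inv (gram x)"]
  show "linear (\<lambda>y. christoffel2 x y w)" "linear (\<lambda>w. christoffel2 x y w)"
    unfolding christoffel2_def o_def .
qed

lemma differentiable_christoffel2: "x \<in> U \<Longrightarrow> (\<lambda>z. christoffel2 z y w) differentiable (at x)"
  unfolding christoffel2_def
  by (rule differentiable_matrix_inv_mult[OF open_U])
    (simp_all add: det_gram differentiable_christoffel1, simp add: gram_def differentiable_g)

section \<open>The lifted metric in induced coordinates\<close>

text \<open>Here \<open>\<delta> \<xi>\<close> is the vector of values of the forms \<delta>y on
  \<open>\<xi>\<close>, so this is a g1 + b g2 + c g3 without indices.\<close>

definition lifted_metric ::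
    "real \<Rightarrow> real \<Rightarrow> real \<Rightarrow> (real^'n) \<times> (real^'n) \<Rightarrow> (real^'n) \<times> (real^'n) \<Rightarrow> (real^'n) \<times> (real^'n) \<Rightarrow> real" where
  "lifted_metric a b c p \<xi> \<eta> =
    (let \<delta> = (\<lambda>\<xi>. snd \<xi> + christoffel2 (fst p) (snd p) (fst \<xi>)) in
     a * g (fst p) (fst \<xi>) (fst \<eta>) + b * (g (fst p) (fst \<xi>) (\<delta> \<eta>) + g (fst p) (\<delta> \<xi>) (fst \<eta>))
     + c * g (fst p) (\<delta> \<xi>) (\<delta> \<eta>))"

text \<open>On a vertical vector the connection term of \<delta> vanishes, and in the other entry it
  occurs only inside \<open>g\<close>. There it becomes a first-kind symbol, which is linear in the
  fibre coordinate.\<close>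

lemma lifted_metric_vertical:
  assumes "fst p \<in> U"
  shows "lifted_metric a b c p (0, u) (w1, w2) =
    b * g (fst p) u w1 + c * (g (fst p) u w2 + christoffel1 (fst p) u (snd p) w1)"
  using assms linear_christoffel2(2)[OF assms] bilinear_g[OF assms]
  by (simp add: lifted_metric_def linear_0 bilinear_lzero bilinear_radd g_christoffel2)

lemma lifted_metric_vertical_vertical:
  assumes "fst p \<in> U"
  shows "lifted_metric a b c p (0, u) (0, w) = c * g (fst p) u w"
  using lifted_metric_vertical[OF assms] assms bilinear_g[OF assms] linear_christoffel1(3)[OF assms]
  by (simp add: bilinear_rzero linear_0)

lemma open_UU: "open (U \<times> (UNIV :: (real^'n) set))"
  using open_U by (simp add: open_Times)

lemma fderiv_lifted_metric_vertical:
  assumes "x \<in> U"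
  shows "fderiv (\<lambda>p. lifted_metric a b c p (0, u) (w, 0)) (x, y) k =
    b * fderiv (\<lambda>z. g z u w) x (fst k) +
    c * (fderiv (\<lambda>z. christoffel1 z u y w) x (fst k) + christoffel1 x u (snd k) w)"
proof (rule fderiv_eq)
  have "((\<lambda>p. b * g (fst p) u w + c * christoffel1 (fst p) u (snd p) w) has_derivative
      (\<lambda>k. b * fderiv (\<lambda>z. g z u w) x (fst k) +
        c * (fderiv (\<lambda>z. christoffel1 z u y w) x (fst k) + christoffel1 x u (snd k) w))) (at (x, y))"
    by (intro has_derivative_add has_derivative_mult_right has_derivative_compose_fst differentiable_g
        has_derivative_linear_family_prod[where B="\<lambda>z y. christoffel1 z u y w", OF open_U])
      (use assms in \<open>auto intro: linear_christoffel1 differentiable_christoffel1\<close>)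
  then show "((\<lambda>p. lifted_metric a b c p (0, u) (w, 0)) has_derivative
      (\<lambda>k. b * fderiv (\<lambda>z. g z u w) x (fst k) +
        c * (fderiv (\<lambda>z. christoffel1 z u y w) x (fst k) + christoffel1 x u (snd k) w))) (at (x, y))"
    by (rule has_derivative_transform_within_open[OF _ open_UU])
      (use assms bilinear_g in \<open>auto simp: lifted_metric_vertical bilinear_rzero\<close>)
qed

lemma fderiv_lifted_metric_vertical_vertical:
  assumes "x \<in> U"
  shows "fderiv (\<lambda>p. lifted_metric a b c p (0, u) (0, w)) (x, y) k = c * fderiv (\<lambda>z. g z u w) x (fst k)"
proof (rule fderiv_eq)
  show "((\<lambda>p. lifted_metric a b c p (0, u) (0, w)) has_derivative
      (\<lambda>k. c * fderiv (\<lambda>z. g z u w) x (fst k))) (at (x, y))"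
    by (rule has_derivative_transform_within_open[OF has_derivative_mult_right[OF has_derivative_compose_fst[OF differentiable_g]] open_UU])
      (use assms in \<open>auto simp: lifted_metric_vertical_vertical\<close>)
qed

section \<open>Vertical and horizontal lifts\<close>

text \<open>The components \<open>c * g\<close> depend on the base point only, which the field does
  not move, and the field is constant along fibres, so its derivative in a vertical direction is
  zero.\<close>

lemma lie_deriv_lifted_metric_vertical_lift:
  assumes x: "x \<in> U" and V: "V differentiable (at x)"
  shows "lie_deriv (\<lambda>p. (0, V (fst p))) (lifted_metric a b c) (x, y) (0, u) (0, w) = 0"
proof -
  have "((\<lambda>p. (0::real^'n, V (fst p))) has_derivative (\<lambda>k. (0, fderiv V x (fst k)))) (at (x, y))"
    by (intro has_derivative_Pair has_derivative_const has_derivative_compose_fst V)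
  then have "fderiv (\<lambda>p. (0::real^'n, V (fst p))) (x, y) k = (0, fderiv V x (fst k))" for k
    by (rule fderiv_eq)
  moreover have "linear (fderiv V x)" using V by (rule linear_frechet_derivative)
  ultimately show ?thesis
    using x linear_fderiv_g[OF x] bilinear_g[OF x]
    unfolding lie_deriv_def fderiv_lifted_metric_vertical_vertical[OF x]
    by (simp add: lifted_metric_vertical_vertical linear_0 bilinear_lzero bilinear_rzero)
qed

text \<open>The vanishing is the compatibility \<open>\<nabla>\<^sub>V g = 0\<close>.\<close>

lemma lie_deriv_lifted_metric_horizontal_lift:
  assumes x: "x \<in> U" and V: "V differentiable (at x)"
  shows "lie_deriv (\<lambda>p. (V (fst p), - christoffel2 (fst p) (snd p) (V (fst p)))) (lifted_metric a b c)
    (x, y) (0, u) (0, w) = 0"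
proof -
  let ?B = "\<lambda>z y. christoffel2 z y (V z)"
  have "((\<lambda>p. ?B (fst p) (snd p)) has_derivative
      (\<lambda>k. fderiv (\<lambda>z. ?B z y) x (fst k) + ?B x (snd k))) (at (x, y))"
  proof (rule has_derivative_linear_family_prod[where B="?B", OF open_U x])
    show "(\<lambda>z. christoffel2 z v (V z)) differentiable at x" for v
      by (rule differentiable_linear_family[where B="\<lambda>z. christoffel2 z v", OF open_U x])
        (use V in \<open>auto intro: linear_christoffel2 differentiable_christoffel2[OF x]\<close>)
  qed (rule linear_christoffel2)
  then have "((\<lambda>p. (V (fst p), - ?B (fst p) (snd p))) has_derivative
      (\<lambda>k. (fderiv V x (fst k), - (fderiv (\<lambda>z. ?B z y) x (fst k) + ?B x (snd k))))) (at (x, y))"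
    by (intro has_derivative_Pair has_derivative_minus has_derivative_compose_fst V)
  then have "fderiv (\<lambda>p. (V (fst p), - ?B (fst p) (snd p))) (x, y) k =
      (fderiv V x (fst k), - (fderiv (\<lambda>z. ?B z y) x (fst k) + ?B x (snd k)))" for k
    by (rule fderiv_eq)
  moreover have "linear (fderiv V x)" using V by (rule linear_frechet_derivative)
  moreover have "linear (fderiv (\<lambda>z. ?B z y) x)"
    by (rule linear_frechet_derivative, rule differentiable_linear_family[where B="\<lambda>z. christoffel2 z y", OF open_U x])
        (use V in \<open>auto intro: linear_christoffel2 differentiable_christoffel2[OF x]\<close>)
  moreover have "g x (christoffel2 x v v') u = christoffel1 x u v v'" for v v' u
    using g_christoffel2 g_commute x by metis
  \<comment> \<open>The derivative of the field in the direction \<open>(0, u)\<close> is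
    \<open>(0, - christoffel2 x u (V x))\<close>. The Lie derivative is therefore \<open>c\<close>
    times the derivative of \<open>g\<close> along \<open>V x\<close> minus two first-kind symbols,
    which cancel by \<open>fderiv_g_christoffel1\<close>.\<close>
  ultimately show ?thesis
    using x bilinear_g[OF x]
    unfolding lie_deriv_def fderiv_lifted_metric_vertical_vertical[OF x]
    by (simp add: lifted_metric_vertical_vertical linear_0 bilinear_lneg bilinear_rneg g_christoffel2
      fderiv_g_christoffel1 christoffel1_commute[OF x, of _ "V x"] algebra_simps)
qed

section \<open>The complete lift and its conformal factor\<close>

context
  fixes V :: "real^'n \<Rightarrow> real^'n"
  assumes V: "smooth_on V U"
begin

text \<open>The field differentiated here is the complete lift in induced coordinates (see
  \<open>complete_lift_coords\<close>). Its fibre part is linear in the fibre coordinate.\<close>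

lemma fderiv_complete_lift:
  assumes x: "x \<in> U"
  shows "fderiv (\<lambda>p. (V (fst p), fderiv V (fst p) (snd p))) (x, y) k =
    (fderiv V x (fst k), fderiv (\<lambda>z. fderiv V z y) x (fst k) + fderiv V x (snd k))"
proof (rule fderiv_eq)
  have "((\<lambda>p. fderiv V (fst p) (snd p)) has_derivative
    (\<lambda>k. fderiv (\<lambda>z. fderiv V z y) x (fst k) + fderiv V x (snd k))) (at (x, y))"
    by (rule has_derivative_linear_family_prod[OF open_U x])
      (use V x in \<open>auto intro: linear_frechet_derivative smooth_on_imp_differentiable smooth_on_fderiv\<close>)
  then show "((\<lambda>p. (V (fst p), fderiv V (fst p) (snd p))) has_derivative
    (\<lambda>k. (fderiv V x (fst k), fderiv (\<lambda>z. fderiv V z y) x (fst k) + fderiv V x (snd k)))) (at (x, y))"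
    by (intro has_derivative_Pair has_derivative_compose_fst smooth_on_imp_differentiable[OF V x])
qed

lemma linear_fderiv_V: "x \<in> U \<Longrightarrow> linear (fderiv V x)"
  using smooth_on_imp_differentiable[OF V] linear_frechet_derivative by blast

lemma linear_fderiv2_V: "x \<in> U \<Longrightarrow> linear (fderiv (\<lambda>z. fderiv V z y) x)"
  using smooth_on_imp_differentiable[OF smooth_on_fderiv[OF V]] linear_frechet_derivative by blast

text \<open>In the direction \<open>(0, u)\<close> the lift has derivative
  \<open>(0, fderiv V x u)\<close>, and the vertical components of the metric are those of
  \<open>c * g\<close> at the base point.\<close>

lemma lie_deriv_complete_lift_vertical_vertical:
  assumes x: "x \<in> U"
  shows "lie_deriv (\<lambda>p. (V (fst p), fderiv V (fst p) (snd p))) (lifted_metric a b c) (x, y) (0, u) (0, w) =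
    c * lie_deriv V g x u w"
  using x linear_fderiv_V[OF x] linear_fderiv2_V[OF x]
  unfolding lie_deriv_def fderiv_lifted_metric_vertical_vertical[OF x] fderiv_complete_lift[OF x]
  by (simp add: lifted_metric_vertical_vertical linear_0 algebra_simps)

text \<open>With L the Lie derivative along \<open>V\<close>, the factor of \<open>c\<close> equals
  g(u, (L\<Gamma>)(y, w)) + (Lg)(u, \<Gamma>(y, w)). It is the tensorial Lie derivative of the
  first-kind symbol plus the inhomogeneous term with the second derivative of
  \<open>V\<close>.\<close>

lemma lie_deriv_complete_lift_vertical_horizontal:
  assumes x: "x \<in> U"
  shows "lie_deriv (\<lambda>p. (V (fst p), fderiv V (fst p) (snd p))) (lifted_metric a b c) (x, y) (0, u) (w, 0) =
    b * lie_deriv V g x u w +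
    c * (fderiv (\<lambda>z. christoffel1 z u y w) x (V x) + christoffel1 x u (fderiv V x y) w
      + christoffel1 x (fderiv V x u) y w + christoffel1 x u y (fderiv V x w)
      + g x u (fderiv (\<lambda>z. fderiv V z y) x w))"
  using x linear_fderiv_V[OF x] linear_fderiv2_V[OF x] bilinear_g[OF x]
  unfolding lie_deriv_def fderiv_lifted_metric_vertical[OF x] fderiv_complete_lift[OF x]
  by (simp add: lifted_metric_vertical linear_0 bilinear_rzero algebra_simps)

text \<open>The product rule for each of the three summands. The second derivative of
  \<open>g\<close> is commuted so that \<open>V x\<close> is the outer direction, as it is in the
  affine identity.\<close>

lemma has_derivative_lie_deriv_g:
  assumes x: "x \<in> U"
  shows "((\<lambda>z. lie_deriv V g z u w) has_derivative (\<lambda>k.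
    fderiv (\<lambda>z. fderiv (\<lambda>z. g z u w) z k) x (V x) + fderiv (\<lambda>z. g z u w) x (fderiv V x k)
    + fderiv (\<lambda>z. g z (fderiv V x u) w) x k + g x (fderiv (\<lambda>z. fderiv V z u) x k) w
    + fderiv (\<lambda>z. g z u (fderiv V x w)) x k + g x u (fderiv (\<lambda>z. fderiv V z w) x k))) (at x)"
proof -
  have 1: "((\<lambda>z. fderiv (\<lambda>z. g z u w) z (V z)) has_derivative
      (\<lambda>k. fderiv (\<lambda>z. fderiv (\<lambda>z. g z u w) z (V x)) x k + fderiv (\<lambda>z. g z u w) x (fderiv V x k))) (at x)"
    by (rule has_derivative_linear_family[OF open_U x])
      (use x in \<open>auto intro: linear_fderiv_g smooth_on_imp_differentiable smooth_on_fderiv smooth_g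
        smooth_on_imp_has_derivative V\<close>)
  have 2: "((\<lambda>z. g z (fderiv V z u) w) has_derivative
      (\<lambda>k. fderiv (\<lambda>z. g z (fderiv V x u) w) x k + g x (fderiv (\<lambda>z. fderiv V z u) x k) w)) (at x)" for u w
    by (rule has_derivative_linear_family[where B="\<lambda>z u. g z u w", OF open_U x])
      (use x in \<open>auto intro: linear_g_left differentiable_g smooth_on_fderiv
        smooth_on_imp_has_derivative V\<close>)
  have 3: "((\<lambda>z. g z u (fderiv V z w)) has_derivative
      (\<lambda>k. fderiv (\<lambda>z. g z u (fderiv V x w)) x k + g x u (fderiv (\<lambda>z. fderiv V z w) x k))) (at x)" for u w
    by (rule has_derivative_linear_family[where B="\<lambda>z w. g z u w", OF open_U x])
      (use x in \<open>auto intro: linear_g_right differentiable_g smooth_on_fderiv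
        smooth_on_imp_has_derivative V\<close>)
  show ?thesis
    using has_derivative_add[OF has_derivative_add[OF 1 2] 3]
    unfolding lie_deriv_def second_fderiv_commute[OF smooth_g open_U x, of _ _ _ "V x"]
    by (simp add: algebra_simps)
qed

text \<open>The compatibility identity \<open>fderiv_g_christoffel1\<close> differentiated along
  \<open>V\<close>, with \<open>k\<close> moved to the last slot by symmetry.\<close>

lemma fderiv_g_along_V:
  assumes x: "x \<in> U"
  shows "fderiv (\<lambda>z. fderiv (\<lambda>z. g z u w) z k) x (V x) =
    fderiv (\<lambda>z. christoffel1 z w u k) x (V x) + fderiv (\<lambda>z. christoffel1 z u w k) x (V x)"
proof (rule fderiv_eq)
  have "((\<lambda>z. christoffel1 z u y w) has_derivative fderiv (\<lambda>z. christoffel1 z u y w) x) (at x)" for u y w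
    using differentiable_christoffel1[OF x] frechet_derivative_works by blast
  then show "((\<lambda>z. fderiv (\<lambda>z. g z u w) z k) has_derivative
    (\<lambda>v. fderiv (\<lambda>z. christoffel1 z w u k) x v + fderiv (\<lambda>z. christoffel1 z u w k) x v)) (at x)"
    by (intro has_derivative_transform_within_open[OF has_derivative_add open_U x])
      (auto simp: fderiv_g_christoffel1 christoffel1_commute[of _ _ k])
qed

lemma conformal_complete_lift:
  fixes \<Omega> :: "(real^'n) \<times> (real^'n) \<Rightarrow> real"
  assumes c: "c \<noteq> 0" and x: "x \<in> U"
    and conf: "\<And>x y \<xi> \<eta>. x \<in> U \<Longrightarrow>
      lie_deriv (\<lambda>p. (V (fst p), fderiv V (fst p) (snd p))) (lifted_metric a b c) (x, y) \<xi> \<eta> =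
      2 * \<Omega> (x, y) * lifted_metric a b c (x, y) \<xi> \<eta>"
    and \<Omega>: "(\<lambda>z. \<Omega> (z, 0)) differentiable (at x)"
  shows "\<Omega> (x, y) = \<Omega> (x, 0)" and "((\<lambda>z. \<Omega> (z, 0)) has_derivative (\<lambda>k. 0)) (at x)"
proof -
  \<comment> \<open>The left-hand side does not contain \<open>y\<close>. This is what makes
    \<Omega> constant along the fibre.\<close>
  have LV: "lie_deriv V g z u w = 2 * \<Omega> (z, y) * g z u w" if "z \<in> U" for z y u w
    using conf[OF that, of y "(0, u)" "(0, w)"] c that
    by (simp add: lie_deriv_complete_lift_vertical_vertical lifted_metric_vertical_vertical)
  \<comment> \<open>Index types are inhabited, so \<open>axis undefined 1\<close> is a nonzero
    vector, and dividing by its squared length isolates \<Omega>.\<close>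
  have pos: "g x (axis i 1) (axis i 1) \<noteq> 0" for i
    using g_pos[OF x, of "axis i 1"] by (simp add: axis_eq_0_iff)
  show fibre: "\<Omega> (x, y) = \<Omega> (x, 0)" for y
    using LV[OF x, of "axis undefined 1" "axis undefined 1" y]
      LV[OF x, of "axis undefined 1" "axis undefined 1" 0] pos by simp
  \<comment> \<open>By \<open>LV\<close> the multiples of \<open>b\<close> cancel, and
    \<open>c\<close> can be divided out. The right-hand side is (Lg)(u, \<Gamma>(y, w)), so what
    remains is L\<Gamma> = 0 without mention of the inverse metric.\<close>
  have affine: "fderiv (\<lambda>z. christoffel1 z u y w) x (V x) + christoffel1 x u (fderiv V x y) w
      + christoffel1 x (fderiv V x u) y w + christoffel1 x u y (fderiv V x w)
      + g x u (fderiv (\<lambda>z. fderiv V z y) x w) = 2 * \<Omega> (x, 0) * christoffel1 x u y w" for u y w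
  proof -
    have "b * (2 * \<Omega> (x, y) * g x u w) +
        c * (fderiv (\<lambda>z. christoffel1 z u y w) x (V x) + christoffel1 x u (fderiv V x y) w
      + christoffel1 x (fderiv V x u) y w + christoffel1 x u y (fderiv V x w)
      + g x u (fderiv (\<lambda>z. fderiv V z y) x w)) =
      2 * \<Omega> (x, y) * (b * g x u w + c * christoffel1 x u y w)"
      using conf[OF x, of y "(0, u)" "(w, 0)"] x bilinear_g[OF x]
      unfolding lie_deriv_complete_lift_vertical_horizontal[OF x] LV[OF x, of u w y]
      by (simp add: lifted_metric_vertical bilinear_rzero)
    moreover have "Q = 2 * o1 * L"
      if "b * (2 * o1 * G) + c * Q = 2 * o1 * (b * G + c * L)" for o1 G Q L :: real
    proof -
      have "c * Q = c * (2 * o1 * L)" using that by (simp add: algebra_simps)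
      then show ?thesis using c by simp
    qed
    ultimately show ?thesis unfolding fibre[of y, symmetric] by blast
  qed
  have d\<Omega>: "((\<lambda>z. \<Omega> (z, 0)) has_derivative fderiv (\<lambda>z. \<Omega> (z, 0)) x) (at x)"
    using \<Omega> frechet_derivative_works by blast
  have "fderiv (\<lambda>z. \<Omega> (z, 0)) x k = 0" for k
  proof -
    define u :: "real^'n" where "u = axis undefined 1"
    \<comment> \<open>The derivative of Lg at \<open>(u, u)\<close> is computed twice: from
      \<open>2 * \<Omega> * g\<close> and from the explicit expansion.\<close>
    have "((\<lambda>z. g z u u) has_derivative fderiv (\<lambda>z. g z u u) x) (at x)"
      using differentiable_g[OF x] frechet_derivative_works by blast
    then have "((\<lambda>z. 2 * (\<Omega> (z, 0) * g z u u)) has_derivative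
      (\<lambda>k. 2 * (\<Omega> (x, 0) * fderiv (\<lambda>z. g z u u) x k + fderiv (\<lambda>z. \<Omega> (z, 0)) x k * g x u u))) (at x)"
      by (intro has_derivative_mult_right has_derivative_mult d\<Omega>)
    then have "((\<lambda>z. lie_deriv V g z u u) has_derivative
      (\<lambda>k. 2 * (\<Omega> (x, 0) * fderiv (\<lambda>z. g z u u) x k + fderiv (\<lambda>z. \<Omega> (z, 0)) x k * g x u u))) (at x)"
      by (rule has_derivative_transform_within_open[OF _ open_U x]) (simp add: LV[of _ _ _ 0])
    note has_derivative_unique[OF this has_derivative_lie_deriv_g[OF x], THEN fun_cong, of k]
    moreover have "fderiv (\<lambda>z. g z v w) x k = christoffel1 x w v k + christoffel1 x v w k" for v w k
      using fderiv_g_christoffel1[OF x] christoffel1_commute[OF x, of _ k] by simp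
    moreover note g_commute[OF x, of "fderiv (\<lambda>z. fderiv V z u) x k" u]
    \<comment> \<open>The right-hand side is twice the left-hand side of \<open>affine\<close> with
      \<open>y = u\<close> and \<open>w = k\<close>. It thus equals the first summand on the left,
      and only the derivative of \<Omega> times \<open>g x u u\<close> survives.\<close>
    ultimately have "4 * (\<Omega> (x, 0) * christoffel1 x u u k) + 2 * (g x u u * fderiv (\<lambda>z. \<Omega> (z, 0)) x k) =
        2 * (fderiv (\<lambda>z. christoffel1 z u u k) x (V x) + christoffel1 x u (fderiv V x u) k
        + christoffel1 x (fderiv V x u) u k + christoffel1 x u u (fderiv V x k)
        + g x u (fderiv (\<lambda>z. fderiv V z u) x k))"
      unfolding fderiv_g_along_V[OF x] by (simp add: algebra_simps)
    then show ?thesis unfolding affine using pos by (simp add: u_def)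
  qed
  then have "fderiv (\<lambda>z. \<Omega> (z, 0)) x = (\<lambda>k. 0)" by (rule ext)
  with d\<Omega> show "((\<lambda>z. \<Omega> (z, 0)) has_derivative (\<lambda>k. 0)) (at x)" by simp
qed

end

end

section \<open>Charts of the tangent bundle\<close>

context
  fixes M :: "('p, 'i, 'e::euclidean_space) manifold"
  assumes M: "smooth_manifold M"
begin

lemma chart_in_topspace: "\<alpha> \<in> charts M \<Longrightarrow> cdom M \<alpha> \<subseteq> topspace (mtop M)"
  and openin_cdom: "\<alpha> \<in> charts M \<Longrightarrow> openin (mtop M) (cdom M \<alpha>)"
  and open_coords: "\<alpha> \<in> charts M \<Longrightarrow> open (cmap M \<alpha> ` cdom M \<alpha>)"
  and homeomorphic_cmap: "\<alpha> \<in> charts M \<Longrightarrow> homeomorphic_map (subtopology (mtop M) (cdom M \<alpha>))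
          (top_of_set (cmap M \<alpha> ` cdom M \<alpha>)) (cmap M \<alpha>)"
  using M unfolding smooth_manifold_def by auto

lemma inj_on_cmap: "\<alpha> \<in> charts M \<Longrightarrow> inj_on (cmap M \<alpha>) (cdom M \<alpha>)"
  using homeomorphic_imp_injective_map[OF homeomorphic_cmap] chart_in_topspace
  by (simp add: Int_absorb1)

lemma chart_inv_cmap: "\<alpha> \<in> charts M \<Longrightarrow> p \<in> cdom M \<alpha> \<Longrightarrow> chart_inv M \<alpha> (cmap M \<alpha> p) = p"
  unfolding chart_inv_def using inj_on_cmap by simp

lemma chart_inv_in_cdom: "x \<in> cmap M \<alpha> ` cdom M \<alpha> \<Longrightarrow> chart_inv M \<alpha> x \<in> cdom M \<alpha>"
  and cmap_chart_inv: "x \<in> cmap M \<alpha> ` cdom M \<alpha> \<Longrightarrow> cmap M \<alpha> (chart_inv M \<alpha> x) = x"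
  unfolding chart_inv_def by (auto intro: inv_into_into f_inv_into_f)

text \<open>The chart is a homeomorphism between open sets, and openness relative to an open set is
  openness.\<close>

lemma openin_chart_iff:
  assumes \<alpha>: "\<alpha> \<in> charts M" and S: "S \<subseteq> cdom M \<alpha>"
  shows "open (cmap M \<alpha> ` S) \<longleftrightarrow> openin (mtop M) S"
proof -
  have "openin (top_of_set (cmap M \<alpha> ` cdom M \<alpha>)) (cmap M \<alpha> ` S) \<longleftrightarrow>
      openin (subtopology (mtop M) (cdom M \<alpha>)) S"
    using homeomorphic_map_openness[OF homeomorphic_cmap[OF \<alpha>]] S chart_in_topspace[OF \<alpha>] by auto
  then show ?thesis
    using S open_coords[OF \<alpha>] openin_cdom[OF \<alpha>]
    by (metis image_mono openin_open_eq openin_open_subtopology)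
qed

lemma open_overlap:
  assumes "\<alpha> \<in> charts M" "openin (mtop M) S"
  shows "open (cmap M \<alpha> ` (cdom M \<alpha> \<inter> S))"
  using assms openin_chart_iff[of \<alpha> "cdom M \<alpha> \<inter> S"] openin_cdom by blast

section \<open>Transition maps and tangent vectors\<close>

lemma transition_cmap:
  "\<alpha> \<in> charts M \<Longrightarrow> p \<in> cdom M \<alpha> \<Longrightarrow> transition M \<alpha> \<beta> (cmap M \<alpha> p) = cmap M \<beta> p"
  by (simp add: transition_def chart_inv_cmap)

lemma transition_has_derivative:
  assumes "\<alpha> \<in> charts M" "\<beta> \<in> charts M" "p \<in> cdom M \<alpha> \<inter> cdom M \<beta>"
  shows "(transition M \<alpha> \<beta> has_derivative fderiv (transition M \<alpha> \<beta>) (cmap M \<alpha> p)) (at (cmap M \<alpha> p))"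
proof (rule smooth_on_imp_has_derivative)
  show "smooth_on (transition M \<alpha> \<beta>) (cmap M \<alpha> ` (cdom M \<alpha> \<inter> cdom M \<beta>))"
    using M assms unfolding smooth_manifold_def by blast
qed (use assms in blast)

lemma fderiv_transition_compose:
  assumes charts: "\<alpha> \<in> charts M" "\<beta> \<in> charts M" "\<gamma> \<in> charts M"
    and p: "p \<in> cdom M \<alpha>" "p \<in> cdom M \<beta>" "p \<in> cdom M \<gamma>"
  shows "fderiv (transition M \<beta> \<gamma>) (cmap M \<beta> p) (fderiv (transition M \<alpha> \<beta>) (cmap M \<alpha> p) y) =
    fderiv (transition M \<alpha> \<gamma>) (cmap M \<alpha> p) y"
proof -
  have "((\<lambda>x. transition M \<beta> \<gamma> (transition M \<alpha> \<beta> x)) has_derivative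
      (\<lambda>y. fderiv (transition M \<beta> \<gamma>) (cmap M \<beta> p) (fderiv (transition M \<alpha> \<beta>) (cmap M \<alpha> p) y)))
      (at (cmap M \<alpha> p))"
    by (rule has_derivative_compose[OF transition_has_derivative])
      (use assms transition_has_derivative in \<open>auto simp: transition_cmap\<close>)
  then have "(transition M \<alpha> \<gamma> has_derivative
      (\<lambda>y. fderiv (transition M \<beta> \<gamma>) (cmap M \<beta> p) (fderiv (transition M \<alpha> \<beta>) (cmap M \<alpha> p) y)))
      (at (cmap M \<alpha> p))"
    by (rule has_derivative_transform_within_open[OF _ open_overlap[OF charts(1) openin_cdom[OF charts(2)]]])
      (use assms in \<open>auto simp: transition_cmap\<close>)
  then show ?thesis by (rule fderiv_eq[symmetric])
qed

lemma fderiv_transition_self: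
  assumes "\<alpha> \<in> charts M" "p \<in> cdom M \<alpha>"
  shows "fderiv (transition M \<alpha> \<alpha>) (cmap M \<alpha> p) y = y"
proof (rule fderiv_eq)
  show "(transition M \<alpha> \<alpha> has_derivative (\<lambda>y. y)) (at (cmap M \<alpha> p))"
    by (rule has_derivative_transform_within_open[OF has_derivative_ident open_coords[OF assms(1)]])
      (use assms in \<open>auto simp: transition_cmap\<close>)
qed

text \<open>The transformation law defines the remaining components. Its consistency is the chain
  rule \<open>fderiv_transition_compose\<close>.\<close>

lemma tangent_space_with_component:
  assumes \<alpha>: "\<alpha> \<in> charts M" "p \<in> cdom M \<alpha>"
  obtains v where "v \<in> tangent_space M p" "v \<alpha> = y"
proof
  define v where "v = (\<lambda>\<beta>. if \<beta> \<in> charts M \<and> p \<in> cdom M \<beta>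
    then fderiv (transition M \<alpha> \<beta>) (cmap M \<alpha> p) y else 0)"
  show "v \<in> tangent_space M p"
    unfolding tangent_space_def
  proof (intro CollectI conjI ballI allI impI)
    fix \<beta> \<gamma> assume "\<beta> \<in> charts M" "\<gamma> \<in> charts M" "p \<in> cdom M \<beta>" "p \<in> cdom M \<gamma>"
    then show "v \<gamma> = fderiv (transition M \<beta> \<gamma>) (cmap M \<beta> p) (v \<beta>)"
      using fderiv_transition_compose[OF \<alpha>(1) _ _ \<alpha>(2)] by (simp add: v_def)
  qed (auto simp: v_def)
  show "v \<alpha> = y"
    using \<alpha> by (simp add: v_def fderiv_transition_self)
qed

lemma tangent_space_eqI:
  assumes "\<alpha> \<in> charts M" "p \<in> cdom M \<alpha>" "v \<in> tangent_space M p" "w \<in> tangent_space M p" "v \<alpha> = w \<alpha>"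
  shows "v = w"
proof
  fix \<beta> show "v \<beta> = w \<beta>"
  proof (cases "\<beta> \<in> charts M \<and> p \<in> cdom M \<beta>")
    case True
    then have *: "u \<beta> = fderiv (transition M \<alpha> \<beta>) (cmap M \<alpha> p) (u \<alpha>)" if "u \<in> tangent_space M p" for u
      using that assms(1,2) unfolding tangent_space_def by blast
    have "v \<beta> = fderiv (transition M \<alpha> \<beta>) (cmap M \<alpha> p) (w \<alpha>)"
      using *[OF assms(3)] unfolding assms(5) .
    also have "\<dots> = w \<beta>" by (rule *[OF assms(4), symmetric])
    finally show ?thesis .
  next
    case False
    then have *: "u \<beta> = 0" if "u \<in> tangent_space M p" for u
      using that unfolding tangent_space_def by blast
    show ?thesis by (simp add: *[OF assms(3)] *[OF assms(4)])
  qed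
qed

section \<open>The induced charts of the tangent bundle\<close>

lemma tangent_bundle_simps:
  "charts (tangent_bundle M) = charts M"
  "(p, v) \<in> cdom (tangent_bundle M) \<alpha> \<longleftrightarrow> p \<in> cdom M \<alpha> \<and> v \<in> tangent_space M p"
  "cmap (tangent_bundle M) \<alpha> (p, v) = (cmap M \<alpha> p, v \<alpha>)"
  by (simp_all add: tangent_bundle_def Let_def)

lemma topspace_tangent_bundle:
  assumes "P \<in> topspace (mtop (tangent_bundle M))"
  obtains \<alpha> where "\<alpha> \<in> charts M" "P \<in> cdom (tangent_bundle M) \<alpha>"
  using assms by (auto simp: tangent_bundle_def Let_def)

lemma coords_tangent_bundle:
  assumes "\<alpha> \<in> charts M"
  shows "cmap (tangent_bundle M) \<alpha> ` cdom (tangent_bundle M) \<alpha> = (cmap M \<alpha> ` cdom M \<alpha>) \<times> UNIV"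
proof (intro equalityI subsetI)
  fix z :: "'e \<times> 'e" assume "z \<in> (cmap M \<alpha> ` cdom M \<alpha>) \<times> UNIV"
  then obtain p y where p: "p \<in> cdom M \<alpha>" "z = (cmap M \<alpha> p, y)" by auto
  obtain v where "v \<in> tangent_space M p" "v \<alpha> = y"
    using tangent_space_with_component[OF assms p(1)] .
  then show "z \<in> cmap (tangent_bundle M) \<alpha> ` cdom (tangent_bundle M) \<alpha>"
    using p by (intro image_eqI[of _ _ "(p, v)"]) (auto simp: tangent_bundle_simps)
qed (auto simp: tangent_bundle_simps)

text \<open>The induced chart is injective because the base chart is and because a tangent vector is
  determined by its component in one chart.\<close>

lemma chart_inv_tangent_bundle_cmap:
  assumes "\<alpha> \<in> charts M" "P \<in> cdom (tangent_bundle M) \<alpha>"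
  shows "chart_inv (tangent_bundle M) \<alpha> (cmap (tangent_bundle M) \<alpha> P) = P"
proof -
  have "inj_on (cmap (tangent_bundle M) \<alpha>) (cdom (tangent_bundle M) \<alpha>)"
  proof (rule inj_onI, clarsimp simp: tangent_bundle_simps)
    fix p v q w
    assume *: "p \<in> cdom M \<alpha>" "q \<in> cdom M \<alpha>" "cmap M \<alpha> p = cmap M \<alpha> q"
      "v \<in> tangent_space M p" "w \<in> tangent_space M q" "v \<alpha> = w \<alpha>"
    then have "p = q" using inj_on_cmap[OF assms(1)] by (simp add: inj_on_eq_iff)
    with * tangent_space_eqI[OF assms(1)] show "p = q \<and> v = w" by blast
  qed
  then show ?thesis using assms(2) by (simp add: chart_inv_def)
qed

lemma chart_inv_tangent_bundle:
  assumes \<alpha>: "\<alpha> \<in> charts M" and x: "x \<in> cmap M \<alpha> ` cdom M \<alpha>"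
  shows "chart_inv (tangent_bundle M) \<alpha> (x, y) \<in> cdom (tangent_bundle M) \<alpha>"
    and "cmap (tangent_bundle M) \<alpha> (chart_inv (tangent_bundle M) \<alpha> (x, y)) = (x, y)"
    and "fst (chart_inv (tangent_bundle M) \<alpha> (x, y)) = chart_inv M \<alpha> x"
    and "snd (chart_inv (tangent_bundle M) \<alpha> (x, y)) \<alpha> = y"
proof -
  let ?P = "chart_inv (tangent_bundle M) \<alpha> (x, y)"
  have "(x, y) \<in> cmap (tangent_bundle M) \<alpha> ` cdom (tangent_bundle M) \<alpha>"
    using x by (simp add: coords_tangent_bundle[OF \<alpha>])
  then show 1: "?P \<in> cdom (tangent_bundle M) \<alpha>" and 2: "cmap (tangent_bundle M) \<alpha> ?P = (x, y)"
    unfolding chart_inv_def by (rule inv_into_into, rule f_inv_into_f)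
  obtain p v where P: "?P = (p, v)" by fastforce
  show "fst ?P = chart_inv M \<alpha> x" "snd ?P \<alpha> = y"
    using 1 2 chart_inv_cmap[OF \<alpha>] unfolding P by (auto simp: tangent_bundle_simps)
qed

end

section \<open>From a chart of the manifold to the calculus on its coordinates\<close>

lemma lie_derivative_eq_lie_deriv:
  assumes "chart_inv M \<alpha> (cmap M \<alpha> p) = p"
  shows "lie_derivative M X G p \<alpha> u w =
    lie_deriv (\<lambda>z. X (chart_inv M \<alpha> z) \<alpha>) (\<lambda>z. G (chart_inv M \<alpha> z) \<alpha>) (cmap M \<alpha> p) u w"
  by (simp add: lie_derivative_def lie_deriv_def assms Let_def)

lemma bilinear_axis_expansion:
  fixes f :: "real^'n \<Rightarrow> real^'m \<Rightarrow> real"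
  assumes "bilinear f"
  shows "f u w = (\<Sum>i\<in>UNIV. \<Sum>j\<in>UNIV. f (axis i 1) (axis j 1) * (u $ i * w $ j))"
proof -
  have "f u w = (\<Sum>i\<in>UNIV. u $ i *\<^sub>R f (axis i 1) w)"
    using assms by (intro linear_axis_expansion[where f="\<lambda>u. f u w"]) (simp add: bilinear_def)
  also have "\<dots> = (\<Sum>i\<in>UNIV. u $ i *\<^sub>R (\<Sum>j\<in>UNIV. w $ j *\<^sub>R f (axis i 1) (axis j 1)))"
    using assms by (intro sum.cong refl arg_cong2[where f=scaleR] linear_axis_expansion) (simp add: bilinear_def)
  finally show ?thesis by (simp add: sum_distrib_left mult_ac)
qed

locale riemannian_chart =
  fixes M :: "('p, 'i, real^'n) manifold" and g :: "('p, 'i, real^'n) tensor2" and \<alpha> :: 'i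
  assumes M: "smooth_manifold M" and riemannian: "riemannian_metric M g" and \<alpha>: "\<alpha> \<in> charts M"
begin

abbreviation "coords \<equiv> cmap M \<alpha> ` cdom M \<alpha>"
abbreviation "g_coords \<equiv> \<lambda>x. g (chart_inv M \<alpha> x) \<alpha>"
abbreviation "TM_inv \<equiv> chart_inv (tangent_bundle M) \<alpha>"

sublocale metric_on_open coords g_coords
proof
  fix x u w assume "x \<in> coords"
  then have "chart_inv M \<alpha> x \<in> cdom M \<alpha>" by (rule chart_inv_in_cdom[OF M])
  then show "bilinear (g_coords x)" "g_coords x u w = g_coords x w u"
    "u \<noteq> 0 \<Longrightarrow> g_coords x u u > 0"
    using riemannian \<alpha> unfolding riemannian_metric_def smooth_covariant_tensor2_def by blast+
next
  show "smooth_on (\<lambda>x. g_coords x u w) coords" for u w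
    using riemannian \<alpha> unfolding riemannian_metric_def smooth_covariant_tensor2_def by blast
qed (rule open_coords[OF M \<alpha>])

lemma christoffel_eq_christoffel2:
  "christoffel M g \<alpha> x k j i = christoffel2 x (axis j 1) (axis i 1) $ k"
proof -
  have "metric_matrix M g \<alpha> x = gram x" by (simp add: metric_matrix_def gram_def)
  then show ?thesis
    unfolding christoffel_def christoffel2_def christoffel1_def
    by (simp add: metric_matrix_def partial_deriv_def matrix_vector_mult_def sum_distrib_left)
qed

lemma christoffel2_expansion:
  assumes "x \<in> coords"
  shows "christoffel2 x y w $ k =
    (\<Sum>a\<in>UNIV. \<Sum>i\<in>UNIV. y $ a * christoffel M g \<alpha> x k a i * w $ i)"
proof -
  have "bilinear (\<lambda>y w. christoffel2 x y w $ k)"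
    using linear_christoffel2[OF assms] unfolding bilinear_def linear_iff by simp
  from bilinear_axis_expansion[OF this, of y w] show ?thesis
    by (simp add: christoffel_eq_christoffel2 mult_ac)
qed

context
  fixes x assumes x: "x \<in> coords"
begin

lemmas TM_inv = chart_inv_tangent_bundle[OF M \<alpha> x]
lemmas cmap_TM_inv = cmap_chart_inv[OF M x]

lemma coframe_dy_coords:
  "coframe_dy M g (TM_inv (x, y)) \<alpha> h \<xi> = (snd \<xi> + christoffel2 x y (fst \<xi>)) $ h"
  by (simp add: coframe_dy_def TM_inv cmap_TM_inv christoffel2_expansion[OF x])

lemma lift_metric_coords:
  "lift_metric M g a b c (TM_inv (x, y)) \<alpha> \<xi> \<eta> = lifted_metric a b c (x, y) \<xi> \<eta>"
proof -
  define \<delta> where "\<delta> \<xi> = snd \<xi> + christoffel2 x y (fst \<xi>)" for \<xi> :: "(real^'n) \<times> (real^'n)"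
  have dy: "coframe_dy M g (TM_inv (x, y)) \<alpha> h \<xi> = \<delta> \<xi> $ h" for h \<xi>
    unfolding coframe_dy_coords \<delta>_def ..
  note expansion = bilinear_axis_expansion[OF bilinear_g[OF x]]
  have "metric1 M g (TM_inv (x, y)) \<alpha> \<xi> \<eta> = g_coords x (fst \<xi>) (fst \<eta>)"
    unfolding metric1_def coframe_dx_def TM_inv by (rule expansion[symmetric])
  \<comment> \<open>In the second product of \<open>metric2\<close> the index \<open>i\<close>
    belongs to \<open>\<eta>\<close> and \<open>j\<close> to \<open>\<xi>\<close>, so the sum yields
    \<open>g\<close> at \<open>fst \<eta>\<close> and \<open>\<delta> \<xi>\<close>; symmetry of
    \<open>g\<close> exchanges them.\<close>
  moreover have "metric2 M g (TM_inv (x, y)) \<alpha> \<xi> \<eta> = g_coords x (fst \<xi>) (\<delta> \<eta>) + g_coords x (\<delta> \<xi>) (fst \<eta>)"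
    unfolding metric2_def coframe_dx_def dy TM_inv g_commute[OF x, of "\<delta> \<xi>"]
      expansion[of "fst \<xi>"] expansion[of "fst \<eta>"]
    by (simp add: sum.distrib algebra_simps)
  moreover have "metric3 M g (TM_inv (x, y)) \<alpha> \<xi> \<eta> = g_coords x (\<delta> \<xi>) (\<delta> \<eta>)"
    unfolding metric3_def dy TM_inv by (rule expansion[symmetric])
  ultimately show ?thesis
    by (simp add: lift_metric_def lifted_metric_def Let_def \<delta>_def)
qed

lemma horizontal_lift_coords:
  "horizontal_lift M g V (TM_inv (x, y)) \<alpha> =
    (V (chart_inv M \<alpha> x) \<alpha>, - christoffel2 x y (V (chart_inv M \<alpha> x) \<alpha>))"
proof (rule prod_eqI)
  show "fst (horizontal_lift M g V (TM_inv (x, y)) \<alpha>) =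
      fst (V (chart_inv M \<alpha> x) \<alpha>, - christoffel2 x y (V (chart_inv M \<alpha> x) \<alpha>))"
    using basis_expansion[of "V (chart_inv M \<alpha> x) \<alpha>"]
    by (simp add: horizontal_lift_def frame_h_def TM_inv fst_sum scalar_mult_eq_scaleR)
  show "snd (horizontal_lift M g V (TM_inv (x, y)) \<alpha>) =
      snd (V (chart_inv M \<alpha> x) \<alpha>, - christoffel2 x y (V (chart_inv M \<alpha> x) \<alpha>))"
    unfolding vec_eq_iff
  proof
    fix k
    have "christoffel2 x y w $ k = (\<Sum>i\<in>UNIV. w $ i * (\<Sum>a\<in>UNIV. y $ a * christoffel M g \<alpha> x k a i))" for w
      unfolding christoffel2_expansion[OF x]
      by (subst sum.swap) (simp add: sum_distrib_left mult_ac)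
    then show "snd (horizontal_lift M g V (TM_inv (x, y)) \<alpha>) $ k =
        snd (V (chart_inv M \<alpha> x) \<alpha>, - christoffel2 x y (V (chart_inv M \<alpha> x) \<alpha>)) $ k"
      by (simp add: horizontal_lift_def frame_h_def TM_inv cmap_TM_inv snd_sum sum_negf)
  qed
qed

lemma vertical_lift_coords:
  "vertical_lift V (TM_inv (x, y)) \<alpha> = (0, V (chart_inv M \<alpha> x) \<alpha>)"
  using basis_expansion[of "V (chart_inv M \<alpha> x) \<alpha>"]
  by (intro prod_eqI) (simp_all add: vertical_lift_def frame_v_def TM_inv fst_sum snd_sum scalar_mult_eq_scaleR)

text \<open>The Christoffel terms of the two summands of the complete lift cancel.\<close>

lemma complete_lift_coords:
  assumes "(\<lambda>z. V (chart_inv M \<alpha> z) \<alpha>) differentiable (at x)"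
  shows "complete_lift M g V (TM_inv (x, y)) \<alpha> =
    (V (chart_inv M \<alpha> x) \<alpha>, fderiv (\<lambda>z. V (chart_inv M \<alpha> z) \<alpha>) x y)"
proof -
  let ?V = "\<lambda>z. V (chart_inv M \<alpha> z) \<alpha>"
  have V: "(?V has_derivative fderiv ?V x) (at x)"
    using assms frechet_derivative_works by blast
  have partial: "partial_deriv (\<lambda>z. ?V z $ h) m x = fderiv ?V x (axis m 1) $ h" for h m
    unfolding partial_deriv_def
    by (rule fderiv_eq[OF bounded_linear.has_derivative[OF bounded_linear_vec_nth V]])
  have "(\<Sum>m\<in>UNIV. y $ m * ((\<Sum>a\<in>UNIV. christoffel M g \<alpha> x h m a * ?V x $ a) + fderiv ?V x (axis m 1) $ h))
      = (christoffel2 x y (?V x) + fderiv ?V x y) $ h" for h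
    unfolding linear_axis_expansion[OF linear_frechet_derivative[OF assms], of y]
    by (simp add: christoffel2_expansion[OF x] sum.distrib sum_distrib_left algebra_simps)
  moreover have "complete_lift M g V (TM_inv (x, y)) \<alpha> = horizontal_lift M g V (TM_inv (x, y)) \<alpha> +
      (\<Sum>h\<in>UNIV. (\<Sum>m\<in>UNIV. y $ m * ((\<Sum>a\<in>UNIV. christoffel M g \<alpha> x h m a * ?V x $ a)
        + fderiv ?V x (axis m 1) $ h)) *\<^sub>R frame_v h)"
    unfolding complete_lift_def horizontal_lift_def by (simp add: Let_def TM_inv cmap_TM_inv partial)
  ultimately have "complete_lift M g V (TM_inv (x, y)) \<alpha> = horizontal_lift M g V (TM_inv (x, y)) \<alpha> +
      (\<Sum>h\<in>UNIV. (christoffel2 x y (?V x) + fderiv ?V x y) $ h *\<^sub>R frame_v h)"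
    by simp
  also have "(\<Sum>h\<in>UNIV. w $ h *\<^sub>R frame_v h) = (0, w)" for w :: "real^'n"
    using basis_expansion[of w]
    by (intro prod_eqI) (simp_all add: frame_v_def fst_sum snd_sum scalar_mult_eq_scaleR)
  finally show ?thesis by (simp add: horizontal_lift_coords)
qed

end

text \<open>The coordinate expression \<open>X'\<close> has to agree with \<open>X\<close> on the
  whole chart, since the Lie derivative also differentiates the field.\<close>

lemma conformal_coords:
  assumes conf: "conformal_with (tangent_bundle M) (lift_metric M g a b c) X \<Omega>" and x: "x \<in> coords"
    and X: "\<And>x y. x \<in> coords \<Longrightarrow> X (TM_inv (x, y)) \<alpha> = X' (x, y)"
  shows "lie_deriv X' (lifted_metric a b c) (x, y) \<xi> \<eta> =
    2 * \<Omega> (TM_inv (x, y)) * lifted_metric a b c (x, y) \<xi> \<eta>"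
proof -
  let ?P = "TM_inv (x, y)"
  note P = chart_inv_tangent_bundle[OF M \<alpha> x]
  have "lie_deriv X' (lifted_metric a b c) (x, y) \<xi> \<eta> =
      lie_deriv (\<lambda>z. X (TM_inv z) \<alpha>) (\<lambda>z. lift_metric M g a b c (TM_inv z) \<alpha>) (x, y) \<xi> \<eta>"
    by (rule lie_deriv_cong[OF open_UU]) (use x X lift_metric_coords in auto)
  also have "\<dots> = lie_derivative (tangent_bundle M) X (lift_metric M g a b c) ?P \<alpha> \<xi> \<eta>"
    by (simp add: lie_derivative_eq_lie_deriv P)
  also have "\<dots> = 2 * \<Omega> ?P * lift_metric M g a b c ?P \<alpha> \<xi> \<eta>"
    using conf P(1) \<alpha> unfolding conformal_with_def tangent_bundle_simps(1)[OF M] by blast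
  finally show ?thesis by (simp add: lift_metric_coords[OF x])
qed

lemma TM_inv_cmap:
  assumes "P \<in> cdom (tangent_bundle M) \<alpha>"
  shows "P = TM_inv (cmap M \<alpha> (fst P), snd P \<alpha>)" "cmap M \<alpha> (fst P) \<in> coords"
proof -
  obtain p v where "P = (p, v)" by fastforce
  then show "P = TM_inv (cmap M \<alpha> (fst P), snd P \<alpha>)" "cmap M \<alpha> (fst P) \<in> coords"
    using assms chart_inv_tangent_bundle_cmap[OF M \<alpha> assms] by (simp_all add: tangent_bundle_simps[OF M])
qed

text \<open>For a nonzero vertical vector the conformal equation reads
  \<open>0 = 2 * \<Omega> P * (c * g u u)\<close>, and \<open>g u u\<close> is positive.\<close>

lemma conformal_factor_zero:
  assumes conf: "conformal_with (tangent_bundle M) (lift_metric M g a b c) X \<Omega>"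
    and X: "\<And>x y. x \<in> coords \<Longrightarrow> X (TM_inv (x, y)) \<alpha> = X' (x, y)"
    and vv: "\<And>x y u w. x \<in> coords \<Longrightarrow> lie_deriv X' (lifted_metric a b c) (x, y) (0, u) (0, w) = 0"
    and c: "c \<noteq> 0" and P: "P \<in> cdom (tangent_bundle M) \<alpha>"
  shows "\<Omega> P = 0"
proof -
  define x where "x = cmap M \<alpha> (fst P)"
  define y where "y = snd P \<alpha>"
  have x: "x \<in> coords" and P': "P = TM_inv (x, y)"
    using TM_inv_cmap[OF P] by (auto simp: x_def y_def)
  define u :: "real^'n" where "u = axis undefined 1"
  have "u \<noteq> 0" by (simp add: u_def axis_eq_0_iff)
  then have "g_coords x u u \<noteq> 0" using g_pos[OF x, of u] by simp
  then show ?thesis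
    using conformal_coords[OF conf x X, of y "(0, u)" "(0, u)"] vv[OF x] c x
    by (simp add: lifted_metric_vertical_vertical P')
qed

lemma complete_lift_conformal_factor:
  assumes conf: "conformal_with (tangent_bundle M) (lift_metric M g a b c) (complete_lift M g V) \<Omega>"
    and V: "smooth_vector_field M V" and c: "c \<noteq> 0" and x: "x \<in> coords"
  shows "\<Omega> (TM_inv (x, y)) = \<Omega> (TM_inv (x, 0))"
    and "((\<lambda>z. \<Omega> (TM_inv (z, 0))) has_derivative (\<lambda>k. 0)) (at x)"
proof -
  let ?V = "\<lambda>z. V (chart_inv M \<alpha> z) \<alpha>"
  have V': "smooth_on ?V coords"
    using V \<alpha> unfolding smooth_vector_field_def by blast
  have conf': "lie_deriv (\<lambda>p. (?V (fst p), fderiv ?V (fst p) (snd p))) (lifted_metric a b c) (x, y) \<xi> \<eta> =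
      2 * \<Omega> (TM_inv (x, y)) * lifted_metric a b c (x, y) \<xi> \<eta>" if "x \<in> coords" for x y \<xi> \<eta>
    by (rule conformal_coords[OF conf that])
      (simp add: complete_lift_coords smooth_on_imp_differentiable[OF V'])
  \<comment> \<open>The smoothness of \<Omega> on the bundle, composed with the zero section
    \<open>z \<mapsto> (z, 0)\<close>, gives the differentiability required by
    \<open>conformal_complete_lift\<close>.\<close>
  have "smooth_on (\<lambda>z. \<Omega> (TM_inv z)) (coords \<times> UNIV)"
    using conf \<alpha> unfolding conformal_with_def smooth_function_def tangent_bundle_simps(1)[OF M]
    by (auto simp: coords_tangent_bundle[OF M])
  then have "((\<lambda>z. \<Omega> (TM_inv z)) has_derivative fderiv (\<lambda>z. \<Omega> (TM_inv z)) (x, 0)) (at (x, 0))"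
    by (rule smooth_on_imp_has_derivative) (use x in auto)
  then have "((\<lambda>z. \<Omega> (TM_inv (z, 0))) has_derivative (\<lambda>k. fderiv (\<lambda>z. \<Omega> (TM_inv z)) (x, 0) (k, 0))) (at x)"
    by (rule has_derivative_compose[rotated]) (auto intro!: derivative_eq_intros has_derivative_Pair)
  then have "(\<lambda>z. \<Omega> (TM_inv (z, 0))) differentiable (at x)"
    unfolding differentiable_def by blast
  note conclusion = conformal_complete_lift[OF V' c x, where \<Omega>="\<lambda>z. \<Omega> (TM_inv z)" and a=a and b=b, OF _ this]
  show "\<Omega> (TM_inv (x, y)) = \<Omega> (TM_inv (x, 0))"
    by (rule conclusion(1)) (rule conf')
  show "((\<lambda>z. \<Omega> (TM_inv (z, 0))) has_derivative (\<lambda>k. 0)) (at x)"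
    by (rule conclusion(2)) (rule conf')
qed

end

section \<open>The conformal factors\<close>

text \<open>A level set of \<open>f\<close> and its complement are both open, so a connected space
  cannot meet both.\<close>

lemma connected_space_locally_constant:
  assumes "connected_space X"
    and loc: "\<And>p. p \<in> topspace X \<Longrightarrow> \<exists>N. openin X N \<and> p \<in> N \<and> (\<forall>q\<in>N. f q = f p)"
    and "p \<in> topspace X" "q \<in> topspace X"
  shows "f p = f q"
proof (rule ccontr)
  assume neq: "f p \<noteq> f q"
  let ?S = "\<lambda>P. {r \<in> topspace X. P (f r)}"
  have open_S: "openin X (?S P)" for P
  proof (subst openin_subopen, intro ballI)
    fix r assume r: "r \<in> ?S P"
    then obtain N where N: "openin X N" "r \<in> N" "\<And>q. q \<in> N \<Longrightarrow> f q = f r"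
      using loc[of r] by blast
    have "N \<subseteq> ?S P"
    proof
      fix q assume "q \<in> N"
      then show "q \<in> ?S P"
        using N(3)[of q] openin_subset[OF N(1)] r by auto
    qed
    with N show "\<exists>T. openin X T \<and> r \<in> T \<and> T \<subseteq> ?S P" by blast
  qed
  have "openin X (?S (\<lambda>r. r = f p))" "openin X (?S (\<lambda>r. r \<noteq> f p))"
    by (rule open_S)+
  moreover have "topspace X \<subseteq> ?S (\<lambda>r. r = f p) \<union> ?S (\<lambda>r. r \<noteq> f p)"
    "?S (\<lambda>r. r = f p) \<inter> ?S (\<lambda>r. r \<noteq> f p) = {}" "?S (\<lambda>r. r = f p) \<noteq> {}" "?S (\<lambda>r. r \<noteq> f p) \<noteq> {}"
    using assms(3,4) neq by auto
  ultimately show False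
    using assms(1) unfolding connected_space_def by blast
qed

lemma complete_lift_conformal_factor_constant:
  fixes M :: "('p, 'i, real^'n) manifold"
  assumes M: "smooth_manifold M" and connected: "connected_space (mtop M)" and g: "riemannian_metric M g"
    and c: "c \<noteq> 0" and V: "smooth_vector_field M V"
    and conf: "conformal_with (tangent_bundle M) (lift_metric M g a b c) (complete_lift M g V) \<Omega>"
  shows "\<exists>k. \<forall>P\<in>topspace (mtop (tangent_bundle M)). \<Omega> P = k"
proof -
  have chart: "riemannian_chart M g \<alpha>" if "\<alpha> \<in> charts M" for \<alpha>
    using M g that by unfold_locales
  \<comment> \<open>The restriction of \<Omega> to the zero section, a function on \<open>M\<close>
    independent of charts. By constancy along fibres it determines \<Omega>.\<close>
  define F where "F p = \<Omega> (p, \<lambda>_. 0)" for p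
  \<comment> \<open>The family of zeros is a tangent vector because derivatives of transition maps
    are linear. It is the point with fibre coordinate 0 in every chart.\<close>
  have zero: "chart_inv (tangent_bundle M) \<alpha> (cmap M \<alpha> p, 0) = (p, \<lambda>_. 0)"
    if "\<alpha> \<in> charts M" "p \<in> cdom M \<alpha>" for \<alpha> p
  proof -
    have "linear (fderiv (transition M \<alpha> \<beta>) (cmap M \<alpha> p))"
      if "\<alpha> \<in> charts M" "\<beta> \<in> charts M" "p \<in> cdom M \<alpha>" "p \<in> cdom M \<beta>" for \<alpha> \<beta>
      using transition_has_derivative[OF M, of \<alpha> \<beta> p] that has_derivative_linear by blast
    then have "(\<lambda>_. 0) \<in> tangent_space M p"
      by (simp add: tangent_space_def linear_0)
    then show ?thesis
      using chart_inv_tangent_bundle_cmap[OF M that(1), of "(p, \<lambda>_. 0)"] that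
      by (simp add: tangent_bundle_simps[OF M])
  qed
  have \<Omega>: "\<Omega> P = F (fst P)" "fst P \<in> topspace (mtop M)"
    if P: "P \<in> topspace (mtop (tangent_bundle M))" for P
  proof -
    obtain \<alpha> where in_chart: "\<alpha> \<in> charts M" "P \<in> cdom (tangent_bundle M) \<alpha>"
      using topspace_tangent_bundle[OF M P] .
    interpret riemannian_chart M g \<alpha> using chart[OF in_chart(1)] .
    have fst: "fst P \<in> cdom M \<alpha>" using in_chart(2) by (metis prod.collapse tangent_bundle_simps(2)[OF M])
    then show "fst P \<in> topspace (mtop M)" using chart_in_topspace[OF M in_chart(1)] by blast
    show "\<Omega> P = F (fst P)"
      using complete_lift_conformal_factor(1)[OF conf V c TM_inv_cmap(2)[OF in_chart(2)], of "snd P \<alpha>"]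
        TM_inv_cmap(1)[OF in_chart(2)] zero[OF in_chart(1) fst] by (simp add: F_def)
  qed
  have "\<exists>N. openin (mtop M) N \<and> p \<in> N \<and> (\<forall>q\<in>N. F q = F p)" if "p \<in> topspace (mtop M)" for p
  proof -
    obtain \<alpha> where in_chart: "\<alpha> \<in> charts M" "p \<in> cdom M \<alpha>"
      using \<open>p \<in> topspace (mtop M)\<close> M unfolding smooth_manifold_def by auto
    interpret riemannian_chart M g \<alpha> using chart[OF in_chart(1)] .
    obtain r where r: "r > 0" "ball (cmap M \<alpha> p) r \<subseteq> coords"
      using open_U in_chart(2) by (meson imageI open_contains_ball)
    \<comment> \<open>The chart preimage of a ball: a vanishing derivative forces constancy only on
      a connected set of coordinates.\<close>
    define N where "N = {q \<in> cdom M \<alpha>. cmap M \<alpha> q \<in> ball (cmap M \<alpha> p) r}"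
    have "cmap M \<alpha> ` N = ball (cmap M \<alpha> p) r"
      using r(2) by (auto simp: N_def)
    then have "openin (mtop M) N"
      using openin_chart_iff[OF M in_chart(1), of N] by (auto simp: N_def)
    moreover have "F q = F p" if "q \<in> N" for q
    proof -
      have deriv: "((\<lambda>z. \<Omega> (TM_inv (z, 0))) has_derivative (\<lambda>k. 0)) (at z within ball (cmap M \<alpha> p) r)"
        if "z \<in> ball (cmap M \<alpha> p) r" for z
      proof (rule has_derivative_at_withinI, rule complete_lift_conformal_factor(2)[OF conf V c])
        show "z \<in> coords" using that r(2) by blast
      qed
      have "(\<lambda>z. \<Omega> (TM_inv (z, 0))) constant_on ball (cmap M \<alpha> p) r"
      proof (rule has_derivative_zero_connected_constant_on[of _ "{}"])
        show "continuous_on (ball (cmap M \<alpha> p) r) (\<lambda>z. \<Omega> (TM_inv (z, 0)))"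
          by (rule has_derivative_continuous_on) (rule deriv)
      qed (simp_all add: deriv)
      then obtain k where "\<And>z. z \<in> ball (cmap M \<alpha> p) r \<Longrightarrow> \<Omega> (TM_inv (z, 0)) = k"
        unfolding constant_on_def by blast
      then have "\<Omega> (TM_inv (cmap M \<alpha> q, 0)) = \<Omega> (TM_inv (cmap M \<alpha> p, 0))"
        using that r(1) by (simp add: N_def)
      then show ?thesis
        using that in_chart by (simp add: F_def zero N_def)
    qed
    moreover have "p \<in> N" using in_chart(2) r(1) by (simp add: N_def)
    ultimately show ?thesis by blast
  qed
  note connected_space_locally_constant[where f=F, OF connected this]
  then obtain k where "\<And>p. p \<in> topspace (mtop M) \<Longrightarrow> F p = k" by blast
  then have "\<Omega> P = k" if "P \<in> topspace (mtop (tangent_bundle M))" for P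
    using \<Omega>[OF that] by simp
  then show ?thesis by blast
qed

theorem theorem1:
  fixes M :: "('p, 'i, real^'n) manifold"
    and g :: "('p, 'i, real^'n) tensor2"
    and V :: "'p \<Rightarrow> 'i \<Rightarrow> real^'n"
    and a b c :: real
  assumes "smooth_manifold M"
    and "connected_space (mtop M)"
    and "riemannian_metric M g"
    and "a > 0" and "b > 0" and "c > 0"
    and "a * c - b\<^sup>2 \<noteq> 0"
    and "smooth_vector_field M V"
  shows "(conformal_vector_field (tangent_bundle M) (lift_metric M g a b c) (complete_lift M g V) \<longrightarrow>
          homothetic_vector_field (tangent_bundle M) (lift_metric M g a b c) (complete_lift M g V)) \<and>
         (conformal_vector_field (tangent_bundle M) (lift_metric M g a b c) (horizontal_lift M g V) \<longrightarrow>
          killing_vector_field (tangent_bundle M) (lift_metric M g a b c) (horizontal_lift M g V)) \<and>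
         (conformal_vector_field (tangent_bundle M) (lift_metric M g a b c) (vertical_lift V) \<longrightarrow>
          killing_vector_field (tangent_bundle M) (lift_metric M g a b c) (vertical_lift V))"
proof (intro conjI impI)
  have c: "c \<noteq> 0" using \<open>c > 0\<close> by simp
  have chart: "riemannian_chart M g \<alpha>" if "\<alpha> \<in> charts M" for \<alpha>
    using assms(1,3) that by unfold_locales
  have differentiable: "(\<lambda>z. V (chart_inv M \<alpha> z) \<alpha>) differentiable (at x)"
    if "\<alpha> \<in> charts M" "x \<in> cmap M \<alpha> ` cdom M \<alpha>" for \<alpha> x
  proof (rule smooth_on_imp_differentiable[OF _ that(2)])
    show "smooth_on (\<lambda>z. V (chart_inv M \<alpha> z) \<alpha>) (cmap M \<alpha> ` cdom M \<alpha>)"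
      using assms(8) that(1) unfolding smooth_vector_field_def by blast
  qed
  show "homothetic_vector_field (tangent_bundle M) (lift_metric M g a b c) (complete_lift M g V)"
    if "conformal_vector_field (tangent_bundle M) (lift_metric M g a b c) (complete_lift M g V)"
    using that complete_lift_conformal_factor_constant[OF assms(1-3) c assms(8)]
    unfolding conformal_vector_field_def homothetic_vector_field_def by blast
  show "killing_vector_field (tangent_bundle M) (lift_metric M g a b c) (horizontal_lift M g V)"
    if "conformal_vector_field (tangent_bundle M) (lift_metric M g a b c) (horizontal_lift M g V)"
  proof -
    from that obtain \<Omega> where
      conf: "conformal_with (tangent_bundle M) (lift_metric M g a b c) (horizontal_lift M g V) \<Omega>"
      unfolding conformal_vector_field_def by blast
    \<comment> \<open>The factor obtained from conformality itself vanishes, so it also witnesses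
      the Killing property.\<close>
    have "\<Omega> P = 0" if P: "P \<in> topspace (mtop (tangent_bundle M))" for P
    proof -
      obtain \<alpha> where in_chart: "\<alpha> \<in> charts M" "P \<in> cdom (tangent_bundle M) \<alpha>"
        using topspace_tangent_bundle[OF assms(1) P] .
      interpret riemannian_chart M g \<alpha> using chart[OF in_chart(1)] .
      show ?thesis
        by (rule conformal_factor_zero[OF conf, where X' = "\<lambda>p. (V (chart_inv M \<alpha> (fst p)) \<alpha>,
              - christoffel2 (fst p) (snd p) (V (chart_inv M \<alpha> (fst p)) \<alpha>))", OF _ _ c in_chart(2)])
          (simp_all add: horizontal_lift_coords differentiable[OF in_chart(1)]
            lie_deriv_lifted_metric_horizontal_lift[where V="\<lambda>z. V (chart_inv M \<alpha> z) \<alpha>"])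
    qed
    with conf show ?thesis unfolding killing_vector_field_def by blast
  qed
  show "killing_vector_field (tangent_bundle M) (lift_metric M g a b c) (vertical_lift V)"
    if "conformal_vector_field (tangent_bundle M) (lift_metric M g a b c) (vertical_lift V)"
  proof -
    from that obtain \<Omega> where
      conf: "conformal_with (tangent_bundle M) (lift_metric M g a b c) (vertical_lift V) \<Omega>"
      unfolding conformal_vector_field_def by blast
    have "\<Omega> P = 0" if P: "P \<in> topspace (mtop (tangent_bundle M))" for P
    proof -
      obtain \<alpha> where in_chart: "\<alpha> \<in> charts M" "P \<in> cdom (tangent_bundle M) \<alpha>"
        using topspace_tangent_bundle[OF assms(1) P] .
      interpret riemannian_chart M g \<alpha> using chart[OF in_chart(1)] .
      show ?thesis
        by (rule conformal_factor_zero[OF conf, where X' = "\<lambda>p. (0, V (chart_inv M \<alpha> (fst p)) \<alpha>)",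
              OF _ _ c in_chart(2)])
          (simp_all add: vertical_lift_coords differentiable[OF in_chart(1)]
            lie_deriv_lifted_metric_vertical_lift[where V="\<lambda>z. V (chart_inv M \<alpha> z) \<alpha>"])
    qed
    with conf show ?thesis unfolding killing_vector_field_def by blast
  qed
qed

end
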